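(* Let $W:G\times G\times G\to\mathbb R$, $(X_A,X_U,X_B)\mapsto W(X_A,X_U,X_B)$, be a potential satisfying the regularity assumption stated in the context, let $X_{U,1},\dots,X_{U,K}\in G$ be known control poses, $y_1,\dots,y_K\in\mathbb R^6$ measured wrenches, $\Sigma_w\succ0$ a $6\times6$ covariance matrix, and $\bar X_B\in G$ a nominal pose, such that the points $(\bar X_{A,k}^\star,X_{U,k},\bar X_B)$ with $\bar X_{A,k}^\star:=X_A^\star(X_{U,k},\bar X_B)$ lie in the neighborhood of interest. Suppose that for each $k=1,\dots,K$ the residual map $r_k:G\to\mathbb R^6$, $r_k(X_B)=y_k+\partial_{\xi_U}W^\star(X_{U,k},X_B)$, is twice continuously differentiable in a neighborhood of $\bar X_B$ under the right-perturbation coordinate $\xi_B$. Let $J_k:=\partial r_k(\bar X_B\oplus\xi_B)/\partial\xi_B|_{\xi_B=0}\in\mathbb R^{6\times6}$, let $J\in\mathbb R^{6K\times6}$ be the vertical stack of $J_1,\dots,J_K$, let $\Sigma_K:=I_K\otimes\Sigma_w$, and let $\bar r_k:=r_k(\bar X_B)$. Then: (i) For each $k$, $$J_k=W_{UB}-W_{UA}W_{AA}^{-1}W_{AB},$$ with all Hessian blocks evaluated at $(\bar X_{A,k}^\star,X_{U,k},\bar X_B)$. In particular, if $W(X_A,X_U,X_B)=W_{\rm ctrl}(X_A,X_U)+W_{\rm int}(X_A,X_B)$, then $W_{UB}=0$ and $J_k=-W_{UA}W_{AA}^{-1}W_{AB}$. (ii) For each $k$, $r_k(\bar X_B\oplus\xi_B)=\bar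 r_k+J_k\xi_B+O(\|\xi_B\|^2)$ as $\xi_B\to0$. Consequently the data energy $J_{\rm data}(X_B)=\frac12\sum_{k=1}^K r_k(X_B)^\top\Sigma_w^{-1}r_k(X_B)$ admits the local Gauss--Newton quadratic model (the function of $\xi_B$ obtained by replacing each $r_k(\bar X_B\oplus\xi_B)$ by $\bar r_k+J_k\xi_B$) $$\widehat J_{\rm data}(\bar X_B\oplus\xi_B)=J_{\rm data}(\bar X_B)+g_{\rm data}^\top\xi_B+\tfrac12\xi_B^\top H_{\rm data}\xi_B,$$ where $$g_{\rm data}=\sum_{k=1}^KJ_k^\top\Sigma_w^{-1}\bar r_k,\qquad H_{\rm data}=\sum_{k=1}^KJ_k^\top\Sigma_w^{-1}J_k.$$ (iii) The matrix $I(\bar X_B):=H_{\rm data}=J^\top\Sigma_K^{-1}J$ is the Fisher information matrix, with respect to $\xi_B$, of the local linearized Gaussian wrench observation model at $\bar X_B$. The pose perturbation $\xi_B$ is identifiable to first order at $\bar X_B$ if and only if $J$ has full column rank, equivalently $I(\bar X_B)\succ0$. If $I(\bar X_B)$ is rank deficient, then there exists $\xi_B\neq0$ with $J_k\xi_B=0$ for all $k=1,\dots,K$; along such a direction the linearized wrench log-likelihood has zero curvature, i.e. $\xi_B^\top H_{\rm data}\xi_B=0$, so the data do not penalize this perturbation to second order in the local Gauss--Newton model.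
   Context: $G:=\mathrm{SO}(3)\times\mathbb R^3$. For $X=(R,p)\in G$ and $\xi=[\phi^\top,v^\top]^\top\in\mathbb R^6$ the right perturbation is $X\oplus\xi:=(R\exp(\phi^\wedge),p+v)$, where $\phi^\wedge\in\mathfrak{so}(3)$ is the usual skew matrix of $\phi$ (hat map). All derivatives $\partial_{\xi_A},\partial_{\xi_U},\partial_{\xi_B}$ are taken in right-perturbation coordinates of $X_A,X_U,X_B$ respectively, at zero perturbation unless stated otherwise. $\|\cdot\|$ is any fixed norm on $\mathbb R^6$. Regularity assumption: $W$ is $C^2$ in a neighborhood of interest. For every $(X_U,X_B)$ in this neighborhood there is a locally unique quasi-static equilibrium $X_A^\star(X_U,X_B)$ satisfying $\operatorname{grad}_{X_A}W(X_A^\star(X_U,X_B),X_U,X_B)=0$, and the Hessian block of $W$ with respect to $X_A$ at the equilibrium is nonsingular; hence, by the implicit function theorem, $X_A^\star$ is locally $C^1$ in $(X_U,X_B)$. Hessian blocks: for $\alpha,\beta\in\{A,U,B\}$, $W_{\alpha\beta}:=\partial_{\xi_\alpha}\partial_{\xi_\beta}W(\bar X_A\oplus\xi_A,\bar X_U\oplus\xi_U,\bar X_B\oplus\xi_B)|_{\xi_A=\xi_U=\xi_B=0}\in\mathbb R^{6\times6}$, with rows indexed by the components of $\xi_\alpha$ and columns by those of $\xi_\beta$. Reduced potential: $W^\star(X_U,X_B):=W(X_A^\star(X_U,X_B),X_U,X_B)$. Predicted wrench: $h_k(X_B)=\widehat y_k(X_B):=-\partial_{\xi_U}W^\star(X_{U,k},X_B)$.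 Residual: $r_k(X_B):=y_k-h_k(X_B)$. Measurement model: $y_k=h_k(X_B)+\varepsilon_k$ with independent $\varepsilon_k\sim\mathcal N(0,\Sigma_w)$. Local linearized Gaussian observation model at $\bar X_B$: the model for the stacked measurements with parameter $\xi_B\in\mathbb R^6$ in which each residual is replaced by its linearization, $\bar r_k+J_k\xi_B$, with independent Gaussian noise of covariance $\Sigma_w$ for each $k$ (stacked covariance $\Sigma_K$), i.e. $y_k\sim\mathcal N(h_k(\bar X_B)-J_k\xi_B,\Sigma_w)$. "Identifiable to first order" means that the linearized residual map determines $\xi_B$, i.e. $\xi_B\mapsto J\xi_B$ is injective. *)

theory Defs
  imports "HOL-Analysis.Analysis" "HOL-Library.Landau_Symbols"
begin

section \<open>Poses and right perturbations\<close>

type_synonym pose = "(real^3^3) \<times> (real^3)"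

definition poses :: "pose set" where
  "poses = {R. rotation_matrix R} \<times> UNIV"

primrec mat_power :: "real^'n^'n \<Rightarrow> nat \<Rightarrow> real^'n^'n" where
  "mat_power M 0 = mat 1"
| "mat_power M (Suc n) = M ** mat_power M n"

definition mat_exp :: "real^'n^'n \<Rightarrow> real^'n^'n" where
  "mat_exp M = (\<Sum>n. (1 / fact n) *\<^sub>R mat_power M n)"

definition hat :: "real^3 \<Rightarrow> real^3^3" where
  "hat \<phi> = vector [vector [0, - (\<phi>$3), \<phi>$2],
                    vector [\<phi>$3, 0, - (\<phi>$1)],
                    vector [- (\<phi>$2), \<phi>$1, 0]]"

definition rot_part :: "real^6 \<Rightarrow> real^3" where
  "rot_part \<xi> = vector [\<xi>$1, \<xi>$2, \<xi>$3]"

definition trans_part :: "real^6 \<Rightarrow> real^3" where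
  "trans_part \<xi> = vector [\<xi>$4, \<xi>$5, \<xi>$6]"

definition oplus :: "pose \<Rightarrow> real^6 \<Rightarrow> pose" (infixl "\<oplus>" 65) where
  "X \<oplus> \<xi> = (fst X ** mat_exp (hat (rot_part \<xi>)), snd X + trans_part \<xi>)"


section \<open>Derivatives\<close>

definition grad :: "(real^'n \<Rightarrow> real) \<Rightarrow> real^'n \<Rightarrow> real^'n" where
  "grad f x = (\<chi> i. frechet_derivative f (at x) (axis i 1))"

definition C2_near :: "('a::real_normed_vector \<Rightarrow> 'b::real_normed_vector) \<Rightarrow> 'a \<Rightarrow> bool" where
  "C2_near f x \<longleftrightarrow>
     (\<exists>S (f' :: 'a \<Rightarrow> 'a \<Rightarrow>\<^sub>L 'b) (f'' :: 'a \<Rightarrow> 'a \<Rightarrow>\<^sub>L ('a \<Rightarrow>\<^sub>L 'b)).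
        open S \<and> x \<in> S \<and>
        (\<forall>z\<in>S. (f has_derivative blinfun_apply (f' z)) (at z)) \<and>
        (\<forall>z\<in>S. (f' has_derivative blinfun_apply (f'' z)) (at z)) \<and>
        continuous_on S f'')"

text \<open>A function of three poses, read in right-perturbation coordinates centred at a triple.
  These coordinates are charts of the manifold, so being C2 near 0 in them
  is the usual manifold notion of being C2 near the centre.\<close>

definition in_coords ::
  "(pose \<times> pose \<times> pose \<Rightarrow> real) \<Rightarrow> pose \<times> pose \<times> pose
    \<Rightarrow> (real^6) \<times> (real^6) \<times> (real^6) \<Rightarrow> real" where
  "in_coords W X z =
     (case X of (XA, XU, XB) \<Rightarrow> case z of (a, u, b) \<Rightarrow> W (XA \<oplus> a, XU \<oplus> u, XB \<oplus> b))"

definition slotA :: "real^6 \<Rightarrow> (real^6) \<times> (real^6) \<times> (real^6)" where "slotA \<xi> = (\<xi>, 0, 0)"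
definition slotU :: "real^6 \<Rightarrow> (real^6) \<times> (real^6) \<times> (real^6)" where "slotU \<xi> = (0, \<xi>, 0)"
definition slotB :: "real^6 \<Rightarrow> (real^6) \<times> (real^6) \<times> (real^6)" where "slotB \<xi> = (0, 0, \<xi>)"

definition partial_grad ::
  "(real^6 \<Rightarrow> (real^6) \<times> (real^6) \<times> (real^6)) \<Rightarrow> ((real^6) \<times> (real^6) \<times> (real^6) \<Rightarrow> real)
    \<Rightarrow> (real^6) \<times> (real^6) \<times> (real^6) \<Rightarrow> real^6" where
  "partial_grad \<alpha> f z = grad (\<lambda>\<xi>. f (z + \<alpha> \<xi>)) 0"

text \<open>All derivatives are taken in the one chart centred at \<open>X\<close>; in particular the diagonal
  blocks are ordinary second derivatives in that chart, not iterated derivatives along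
  left-invariant vector fields.\<close>

definition hess_block ::
  "(real^6 \<Rightarrow> (real^6) \<times> (real^6) \<times> (real^6)) \<Rightarrow> (real^6 \<Rightarrow> (real^6) \<times> (real^6) \<times> (real^6))
    \<Rightarrow> (pose \<times> pose \<times> pose \<Rightarrow> real) \<Rightarrow> pose \<times> pose \<times> pose \<Rightarrow> real^6^6" where
  "hess_block \<alpha> \<beta> W X =
     (\<chi> i j. partial_grad \<alpha> (\<lambda>z. partial_grad \<beta> (in_coords W X) z $ j) 0 $ i)"


section \<open>Equilibria and the regularity assumption\<close>

definition equilibria ::
  "(pose \<times> pose \<times> pose) set \<Rightarrow> (pose \<times> pose \<times> pose \<Rightarrow> real) \<Rightarrow> pose \<Rightarrow> pose \<Rightarrow> pose set" where
  "equilibria \<Omega> W XU XB =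
     {XA. (XA, XU, XB) \<in> \<Omega> \<and> grad (\<lambda>\<xi>. W (XA \<oplus> \<xi>, XU, XB)) 0 = 0}"

text \<open>\<open>\<Omega>\<close> is the neighbourhood of interest. Local uniqueness is uniform in the parameters:
  on a neighbourhood \<open>N\<close> of \<open>(XU, XB)\<close> the map \<open>XAs\<close> picks the only equilibrium in a fixed open
  set \<open>V\<close>. Uniqueness at each parameter separately would let \<open>XAs\<close> jump between branches of
  equilibria, and the implicit function theorem would not apply to it. That \<open>XAs\<close> is
  continuously differentiable is a consequence and is not assumed.\<close>

definition regular_potential ::
  "(pose \<times> pose \<times> pose) set \<Rightarrow> (pose \<times> pose \<times> pose \<Rightarrow> real) \<Rightarrow> (pose \<times> pose \<Rightarrow> pose) \<Rightarrow> bool" where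
  "regular_potential \<Omega> W XAs \<longleftrightarrow>
     openin (top_of_set (poses \<times> poses \<times> poses)) \<Omega> \<and>
     (\<forall>X\<in>\<Omega>. C2_near (in_coords W X) 0) \<and>
     (\<forall>(XU, XB) \<in> snd ` \<Omega>.
        XAs (XU, XB) \<in> equilibria \<Omega> W XU XB \<and>
        (\<exists>V N. openin (top_of_set poses) V \<and> XAs (XU, XB) \<in> V \<and>
               openin (top_of_set (poses \<times> poses)) N \<and> (XU, XB) \<in> N \<and>
               (\<forall>(XU', XB') \<in> N. V \<inter> equilibria \<Omega> W XU' XB' = {XAs (XU', XB')})) \<and>
        invertible (hess_block slotA slotA W (XAs (XU, XB), XU, XB)))"

definition reduced_potential ::
  "(pose \<times> pose \<times> pose \<Rightarrow> real) \<Rightarrow> (pose \<times> pose \<Rightarrow> pose) \<Rightarrow> pose \<times> pose \<Rightarrow> real" where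
  "reduced_potential W XAs = (\<lambda>(XU, XB). W (XAs (XU, XB), XU, XB))"

definition predicted_wrench ::
  "(pose \<times> pose \<times> pose \<Rightarrow> real) \<Rightarrow> (pose \<times> pose \<Rightarrow> pose) \<Rightarrow> pose \<Rightarrow> pose \<Rightarrow> real^6" where
  "predicted_wrench W XAs XU XB = - grad (\<lambda>\<xi>. reduced_potential W XAs (XU \<oplus> \<xi>, XB)) 0"


section \<open>Matrices and norms\<close>

definition pos_def :: "real^'n^'n \<Rightarrow> bool" where
  "pos_def M \<longleftrightarrow> transpose M = M \<and> (\<forall>x. x \<noteq> 0 \<longrightarrow> 0 < x \<bullet> (M *v x))"

definition kron :: "real^'b^'a \<Rightarrow> real^'d^'c \<Rightarrow> real^('b \<times> 'd)^('a \<times> 'c)" where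
  "kron M N = (\<chi> i j. M $ fst i $ fst j * N $ snd i $ snd j)"

definition vstack :: "('k::finite \<Rightarrow> real^'n^'m) \<Rightarrow> real^'n^('k \<times> 'm)" where
  "vstack J = (\<chi> i. J (fst i) $ snd i)"

definition is_norm :: "('a::real_vector \<Rightarrow> real) \<Rightarrow> bool" where
  "is_norm \<nu> \<longleftrightarrow> (\<forall>x. 0 \<le> \<nu> x) \<and> (\<forall>x. \<nu> x = 0 \<longleftrightarrow> x = 0) \<and>
     (\<forall>c x. \<nu> (c *\<^sub>R x) = \<bar>c\<bar> * \<nu> x) \<and> (\<forall>x y. \<nu> (x + y) \<le> \<nu> x + \<nu> y)"

definition weighted_energy :: "real^'m^'m \<Rightarrow> ('k::finite \<Rightarrow> real^'m) \<Rightarrow> real" where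
  "weighted_energy S e = 1/2 * (\<Sum>k\<in>UNIV. e k \<bullet> (matrix_inv S *v e k))"


section \<open>Gaussian observation model and Fisher information\<close>

definition gaussian_density :: "real^'m \<Rightarrow> real^'m^'m \<Rightarrow> real^'m \<Rightarrow> real" where
  "gaussian_density \<mu> S y =
     exp (- 1/2 * ((y - \<mu>) \<bullet> (matrix_inv S *v (y - \<mu>)))) / sqrt ((2 * pi) ^ CARD('m) * det S)"

text \<open>Joint density of independent measurements with \<open>y $ k\<close> distributed as
  \<open>N(\<mu> k - J k *v \<xi>, S)\<close>.\<close>

definition linearized_likelihood ::
  "('k::finite \<Rightarrow> real^'m) \<Rightarrow> ('k \<Rightarrow> real^'n^'m) \<Rightarrow> real^'m^'m \<Rightarrow> real^'n \<Rightarrow> real^'m^'k \<Rightarrow> real" where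
  "linearized_likelihood \<mu> J S \<xi> y =
     (\<Prod>k\<in>UNIV. gaussian_density (\<mu> k - J k *v \<xi>) S (y $ k))"

text \<open>\<open>p \<theta>\<close> is the density of the observation with respect to Lebesgue measure; the information
  matrix is the second moment of the score.\<close>

definition has_fisher_information ::
  "(real^'n \<Rightarrow> 'y::euclidean_space \<Rightarrow> real) \<Rightarrow> real^'n \<Rightarrow> real^'n^'n \<Rightarrow> bool" where
  "has_fisher_information p \<theta> M \<longleftrightarrow>
     (\<forall>y. (\<lambda>\<theta>. ln (p \<theta> y)) differentiable (at \<theta>)) \<and>
     (\<forall>i j. has_bochner_integral lborel
        (\<lambda>y. grad (\<lambda>\<theta>. ln (p \<theta> y)) \<theta> $ i * grad (\<lambda>\<theta>. ln (p \<theta> y)) \<theta> $ j * p \<theta> y) (M $ i $ j))"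

definition first_order_identifiable :: "('k::finite \<Rightarrow> real^'n^'m) \<Rightarrow> bool" where
  "first_order_identifiable J \<longleftrightarrow> inj (\<lambda>\<xi>. vstack J *v \<xi>)"

end

theory Submission
  imports Defs "HOL-Probability.Distributions"
begin

text \<open>In the chart centred at the nominal triple, the implicit function theorem solves
  \<open>\<partial>\<^sub>a F = 0\<close> by \<open>a(u, b)\<close>, and local uniqueness identifies \<open>a\<close> with the equilibrium map; this
  needs the transition maps between right-perturbation charts, which are explicit in unit quaternions.
  By the envelope theorem the gradient of the reduced potential in \<open>u\<close> is the partial gradient of \<open>F\<close>
  along \<open>a\<close>; differentiating in \<open>b\<close> and eliminating \<open>\<partial>\<^sub>b a\<close> gives the Schur complement, up to
  symmetry of second derivatives.

  For the Fisher information, the factorization \<open>\<Sigma> = A A\<^sup>T\<close> turns the moments of a Gaussian into those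
  of independent standard normals. The score is a sum of independent centred terms, one per
  measurement, so its second moment is the sum of the individual ones, which is the Gram matrix \<open>H\<close>.\<close>

section \<open>Rotations and their local charts\<close>

text \<open>Two features of the definitions shape the work. \<open>equilibria\<close> takes its
  gradient in the chart centred at the candidate pose, while the implicit function theorem works in
  one fixed chart. Only one direction has to be transferred: a point critical in the fixed chart is
  critical in its own chart. This is the chain rule applied to a vanishing derivative, so
  differentiability of the transition map suffices. Quaternions give it explicitly: their product is
  polynomial, and for rotation angles below pi the vector part recovers the rotation vector through
  arcsin. Second, \<open>W\<close> is C2, so the implicit branch \<open>a\<close> comes with one
  derivative, and differentiating \<open>F (a p, p)\<close> twice by the bare chain rule would
  require two. The envelope identity resolves this: the first derivative in u contains
  \<open>a\<close> but no derivative of \<open>a\<close>, and differentiating it in b uses the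
  derivative of \<open>a\<close> once. On the Gaussian side, the factor \<open>A\<close> comes from
  a basis that is orthonormal for the form x . S y: with these vectors as columns of C, the matrix S
  C is a square-root factor of S.\<close>

text \<open>Euler-Rodrigues matrix of conjugation by the quaternion with scalar part w and vector
  part v. It is left unnormalized: its entries are quadratic forms in (w, v), so that product, Gram
  matrix and determinant become polynomial identities.\<close>

definition quat_rot :: "real \<Rightarrow> real^3 \<Rightarrow> real^3^3" where
  "quat_rot w v = (w\<^sup>2 + v \<bullet> v) *\<^sub>R mat 1 + (2 * w) *\<^sub>R hat v + 2 *\<^sub>R (hat v ** hat v)"

lemmas mat3_simps = vec_eq_iff forall_3 sum_3 matrix_matrix_mult_def mat_def hat_def
  inner_vec_def transpose_def cross3_def

text \<open>The arguments on the right are the scalar and vector parts of the Hamilton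
  product.\<close>

lemma quat_rot_mult:
  "quat_rot w v ** quat_rot w' v' =
   quat_rot (w * w' - v \<bullet> v') (w *\<^sub>R v' + w' *\<^sub>R v + cross3 v v')"
  unfolding quat_rot_def by (simp add: mat3_simps power2_eq_square) (intro conjI; algebra)

lemma quat_rot_transpose_mult:
  "transpose (quat_rot w v) ** quat_rot w v = ((w\<^sup>2 + v \<bullet> v)\<^sup>2) *\<^sub>R mat 1"
  unfolding quat_rot_def by (simp add: mat3_simps power2_eq_square) (intro conjI; algebra)

lemma det_quat_rot: "det (quat_rot w v) = (w\<^sup>2 + v \<bullet> v) ^ 3"
  unfolding quat_rot_def by (simp add: det_3 mat3_simps power2_eq_square power3_eq_cube) algebra

lemma rotation_matrix_quat_rot:
  assumes "w\<^sup>2 + v \<bullet> v = 1"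
  shows "rotation_matrix (quat_rot w v)"
  using quat_rot_transpose_mult[of w v] det_quat_rot[of w v] assms
  by (simp add: rotation_matrix_def orthogonal_matrix)

section \<open>The exponential of a skew matrix: Rodrigues' formula\<close>

text \<open>Cayley-Hamilton: the characteristic polynomial of \<open>hat \<phi>\<close> is x^3 +
  |\<phi>|^2 x. Every power therefore reduces to the identity, \<open>hat \<phi>\<close> or its
  square.\<close>

lemma hat_cubed: "hat \<phi> ** (hat \<phi> ** hat \<phi>) = - ((norm \<phi>)\<^sup>2) *\<^sub>R hat \<phi>"
  unfolding power2_norm_eq_inner by (simp add: mat3_simps) (intro conjI; algebra)

lemma hat_scaleR: "hat (c *\<^sub>R \<phi>) = c *\<^sub>R hat \<phi>"
  by (simp add: mat3_simps)

lemma hat_zero [simp]: "hat 0 = 0"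
  by (simp add: mat3_simps)

lemma quat_rot_10 [simp]: "quat_rot 1 0 = mat 1"
  by (simp add: quat_rot_def)

lemma mat_exp_zero [simp]: "mat_exp 0 = (mat 1 :: real^'n^'n)"
proof -
  have "mat_power (0 :: real^'n^'n) n = (if n = 0 then mat 1 else 0)" for n
    by (cases n) auto
  then have "(\<lambda>n. (1 / fact n) *\<^sub>R mat_power (0 :: real^'n^'n) n) = (\<lambda>n. if n = 0 then mat 1 else 0)"
    by auto
  then show ?thesis
    unfolding mat_exp_def using sums_single[of 0 "\<lambda>_. mat 1 :: real^'n^'n"] sums_unique by metis
qed

text \<open>Odd powers are multiples of \<open>hat \<phi>\<close>, positive even powers multiples of
  its square. \<open>sin_coeff\<close> and \<open>cos_coeff\<close> vanish at the wrong parity,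
  which spares a case split. At n = 0 the cosine term contributes a spurious multiple of the square;
  the last summand cancels it and supplies the identity.\<close>

lemma mat_power_hat:
  assumes "\<phi> \<noteq> 0"
  shows "mat_power (hat \<phi>) n =
     (fact n * (sin_coeff n * norm \<phi> ^ n / norm \<phi>)) *\<^sub>R hat \<phi>
     + (- fact n * (cos_coeff n * norm \<phi> ^ n / (norm \<phi>)\<^sup>2)) *\<^sub>R (hat \<phi> ** hat \<phi>)
     + (if n = 0 then mat 1 + (1 / (norm \<phi>)\<^sup>2) *\<^sub>R (hat \<phi> ** hat \<phi>) else 0)"
proof (induction n)
  case 0
  then show ?case using assms by simp
next
  case (Suc n)
  let ?A = "hat \<phi>" and ?t = "norm \<phi>"
  have t: "?t \<noteq> 0" using assms by simp
  have "mat_power ?A (Suc n) =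
     (fact n * (sin_coeff n * ?t ^ n / ?t)) *\<^sub>R (?A ** ?A)
     + (- fact n * (cos_coeff n * ?t ^ n / ?t\<^sup>2)) *\<^sub>R (?A ** (?A ** ?A))
     + (if n = 0 then ?A + (1 / ?t\<^sup>2) *\<^sub>R (?A ** (?A ** ?A)) else 0)"
    unfolding mat_power.simps Suc
    by (simp add: matrix_add_ldistrib matrix_scalar_ac
          scalar_matrix_assoc[symmetric] del: scaleR_minus_left)
  \<comment> \<open>The correction at n = 0 dies after one multiplication, since A^3 = - t^2
    A.\<close>
  also have "(if n = 0 then ?A + (1 / ?t\<^sup>2) *\<^sub>R (?A ** (?A ** ?A)) else 0) = 0"
    using t by (simp add: hat_cubed)
  also have "(fact n * (sin_coeff n * ?t ^ n / ?t)) =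
      (- fact (Suc n) * (cos_coeff (Suc n) * ?t ^ Suc n / ?t\<^sup>2))"
    using t unfolding cos_coeff_Suc fact_Suc
    by (simp add: power2_eq_square divide_simps del: of_nat_Suc)
  also have "(- fact n * (cos_coeff n * ?t ^ n / ?t\<^sup>2)) *\<^sub>R (?A ** (?A ** ?A))
     = (fact (Suc n) * (sin_coeff (Suc n) * ?t ^ Suc n / ?t)) *\<^sub>R ?A"
    using t unfolding sin_coeff_Suc fact_Suc hat_cubed
    by (simp add: power2_eq_square divide_simps del: of_nat_Suc)
  finally show ?case by simp
qed

text \<open>Dividing by \<open>fact n\<close> cancels the factorials in \<open>mat_power_hat\<close>
  and leaves the sine series, the cosine series and one isolated term.\<close>

lemma mat_exp_hat_rodrigues:
  assumes "\<phi> \<noteq> 0"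
  shows "mat_exp (hat \<phi>) = mat 1 + (sin (norm \<phi>) / norm \<phi>) *\<^sub>R hat \<phi>
      + ((1 - cos (norm \<phi>)) / (norm \<phi>)\<^sup>2) *\<^sub>R (hat \<phi> ** hat \<phi>)"
proof -
  let ?A = "hat \<phi>" and ?t = "norm \<phi>"
  have eq: "(1 / fact n) *\<^sub>R mat_power ?A n =
     (sin_coeff n *\<^sub>R ?t ^ n / ?t) *\<^sub>R ?A + (- (cos_coeff n *\<^sub>R ?t ^ n) / ?t\<^sup>2) *\<^sub>R (?A ** ?A)
     + (if n = 0 then mat 1 + (1 / ?t\<^sup>2) *\<^sub>R (?A ** ?A) else 0)" for n
    unfolding mat_power_hat[OF assms] by (simp add: scaleR_add_right scaleR_diff_right)
  have "(\<lambda>n. (1 / fact n) *\<^sub>R mat_power ?A n) sums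
     ((sin ?t / ?t) *\<^sub>R ?A + (- cos ?t / ?t\<^sup>2) *\<^sub>R (?A ** ?A)
       + (mat 1 + (1 / ?t\<^sup>2) *\<^sub>R (?A ** ?A)))"
    unfolding eq
    by (intro sums_add sums_scaleR_left sums_divide sums_minus sin_converges cos_converges
          sums_single[of 0 "\<lambda>_. mat 1 + (1 / ?t\<^sup>2) *\<^sub>R (?A ** ?A)"])
  then show ?thesis
    unfolding mat_exp_def by (simp add: sums_iff scaleR_left.add diff_divide_distrib algebra_simps)
qed

section \<open>Radial sine and arcsine, the coordinates of unit quaternions\<close>

text \<open>The vector part of the unit quaternion whose rotation vector is 2 v. Since
  \<open>sgn 0 = 0\<close>, the removable singularity at the origin gets the right value.\<close>

definition sin_vec :: "'a::real_inner \<Rightarrow> 'a" where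
  "sin_vec v = sin (norm v) *\<^sub>R sgn v"

definition arcsin_vec :: "'a::real_inner \<Rightarrow> 'a" where
  "arcsin_vec v = arcsin (norm v) *\<^sub>R sgn v"

lemma sin_vec_0 [simp]: "sin_vec 0 = 0" by (simp add: sin_vec_def)
lemma arcsin_vec_0 [simp]: "arcsin_vec 0 = 0" by (simp add: arcsin_vec_def)

lemma norm_sin_vec: "norm (sin_vec v) = \<bar>sin (norm v)\<bar>"
  by (cases "v = 0") (auto simp: sin_vec_def norm_sgn)

lemma sin_vec_inner_self: "sin_vec v \<bullet> sin_vec v = (sin (norm v))\<^sup>2"
  by (simp add: dot_square_norm norm_sin_vec)

text \<open>Half-angle form: \<open>exp \<phi>\<^sup>\<and>\<close> is the rotation of the unit quaternion
  \<open>(cos (|\<phi>|/2), sin (|\<phi>|/2) \<phi>/|\<phi>|)\<close>.\<close>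

lemma mat_exp_hat: "mat_exp (hat \<phi>) = quat_rot (cos (norm \<phi> / 2)) (sin_vec ((1/2) *\<^sub>R \<phi>))"
proof (cases "\<phi> = 0")
  case True
  then show ?thesis by simp
next
  case False
  let ?t = "norm \<phi>" and ?s = "sin (norm \<phi> / 2)" and ?c = "cos (norm \<phi> / 2)"
  have t: "?t \<noteq> 0" using False by simp
  have v: "sin_vec ((1/2) *\<^sub>R \<phi>) = (?s / ?t) *\<^sub>R \<phi>"
    by (simp add: sin_vec_def sgn_scaleR sgn_div_norm)
  have unit: "?c\<^sup>2 + sin_vec ((1/2) *\<^sub>R \<phi>) \<bullet> sin_vec ((1/2) *\<^sub>R \<phi>) = 1"
    by (simp add: sin_vec_inner_self)
  have s: "sin ?t = 2 * ?s * ?c" using sin_double[of "?t/2"] by (simp only: mult_2 field_sum_of_halves)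
  have c: "1 - cos ?t = 2 * ?s\<^sup>2" using cos_double_sin[of "?t/2"] by (simp only: mult_2 field_sum_of_halves)
  have sq: "((?s / ?t) *\<^sub>R hat \<phi>) ** ((?s / ?t) *\<^sub>R hat \<phi>) = (?s\<^sup>2 / ?t\<^sup>2) *\<^sub>R (hat \<phi> ** hat \<phi>)"
    by (simp only: matrix_scalar_ac scalar_matrix_assoc[symmetric] scaleR_scaleR power2_eq_square
          times_divide_times_eq)
  show ?thesis
    unfolding mat_exp_hat_rodrigues[OF False] quat_rot_def unit
    unfolding v s c hat_scaleR sq
    by (simp add: mult.commute mult.left_commute)
qed

lemma rotation_matrix_mat_exp_hat: "rotation_matrix (mat_exp (hat \<phi>))"
  unfolding mat_exp_hat by (rule rotation_matrix_quat_rot) (simp add: sin_vec_inner_self)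

lemma has_derivative_radial_at_0:
  fixes f :: "real \<Rightarrow> real"
  assumes f: "(f has_real_derivative 1) (at 0)" and f0: "f 0 = 0"
  shows "((\<lambda>v::'a::real_inner. f (norm v) *\<^sub>R sgn v) has_derivative (\<lambda>h. h)) (at 0)"
proof -
  have lim: "((\<lambda>t. f t / t) \<longlongrightarrow> 1) (at 0)"
    using f f0 by (simp add: has_field_derivative_iff)
  have "((\<lambda>v::'a. f (norm v) / norm v) \<longlongrightarrow> 1) (at 0)"
    by (rule filterlim_compose[OF lim])
       (auto simp: filterlim_at eventually_at_filter tendsto_norm_zero_iff tendsto_ident_at)
  then have "((\<lambda>v::'a. \<bar>f (norm v) / norm v - 1\<bar>) \<longlongrightarrow> 0) (at 0)"
    using LIM_zero tendsto_rabs_zero by blast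
  moreover have "norm (f (norm v) *\<^sub>R sgn v - v) / norm v = \<bar>f (norm v) / norm v - 1\<bar>" if "v \<noteq> 0" for v :: 'a
  proof -
    have "f (norm v) *\<^sub>R sgn v - v = (f (norm v) / norm v - 1) *\<^sub>R v"
      by (simp add: sgn_div_norm algebra_simps divide_inverse)
    then show ?thesis using that by simp
  qed
  ultimately have "((\<lambda>v::'a. norm (f (norm v) *\<^sub>R sgn v - v) / norm v) \<longlongrightarrow> 0) (at 0)"
    by (subst Lim_cong_within[where g="\<lambda>v::'a. \<bar>f (norm v) / norm v - 1\<bar>"]) auto
  then show ?thesis
    by (simp add: has_derivative_at bounded_linear_ident)
qed

lemma sin_vec_has_derivative_0: "(sin_vec has_derivative (\<lambda>h. h)) (at 0)"
  unfolding sin_vec_def[abs_def]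
  by (rule has_derivative_radial_at_0) (auto intro!: derivative_eq_intros)

text \<open>Away from the origin the chain rule applies, the strict bound keeping
  \<open>arcsin\<close> off its endpoint; at the origin the radial lemma takes over.\<close>

lemma arcsin_vec_differentiable:
  assumes "norm v < 1"
  shows "arcsin_vec differentiable (at v)"
proof (cases "v = 0")
  case True
  have "(arcsin has_real_derivative 1) (at 0)"
    using DERIV_arcsin[of 0] by simp
  then show ?thesis
    unfolding True arcsin_vec_def[abs_def]
    using has_derivative_radial_at_0[of arcsin] differentiableI by fastforce
next
  case False
  have "(arcsin has_real_derivative inverse (sqrt (1 - (norm v)\<^sup>2))) (at (norm v))"
    by (rule DERIV_arcsin) (use assms norm_ge_zero[of v] in linarith)+
  then have "arcsin differentiable (at (norm v))"
    using differentiableI has_field_derivative_imp_has_derivative by blast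
  then have "(arcsin \<circ> norm) differentiable (at v)"
    using differentiable_norm_at[OF False] by (intro differentiable_chain_at)
  then show ?thesis
    unfolding arcsin_vec_def[abs_def] sgn_div_norm o_def
    using False by (intro differentiable_scaleR differentiable_inverse differentiable_norm_at) auto
qed

lemma sin_vec_arcsin_vec: "norm v \<le> 1 \<Longrightarrow> sin_vec (arcsin_vec v) = v"
proof (cases "v = 0")
  case False
  assume "norm v \<le> 1"
  then have n: "norm (arcsin_vec v) = arcsin (norm v)"
    using False arcsin_nonneg[of "norm v"] by (auto simp: arcsin_vec_def norm_sgn)
  have "0 < arcsin (norm v)"
    using False \<open>norm v \<le> 1\<close> arcsin_less_arcsin[of 0 "norm v"] by auto
  then have "sgn (arcsin_vec v) = sgn v"
    by (simp add: arcsin_vec_def sgn_scaleR) (use False in \<open>simp add: sgn_div_norm\<close>)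
  then show ?thesis
    using \<open>norm v \<le> 1\<close> False order_trans[OF _ norm_ge_zero, of "-1" v]
    by (simp add: sin_vec_def n arcsin sgn_div_norm)
qed simp

lemma norm_arcsin_vec: "norm v \<le> 1 \<Longrightarrow> norm (arcsin_vec v) = arcsin (norm v)"
  using arcsin_nonneg[of "norm v"] by (cases "v = 0") (auto simp: arcsin_vec_def norm_sgn)

lemma arcsin_vec_sin_vec:
  assumes "norm v < pi / 2"
  shows "arcsin_vec (sin_vec v) = v"
proof (cases "v = 0")
  case False
  have s: "0 < sin (norm v)"
    using False assms pi_gt_zero by (intro sin_gt_zero) (simp, linarith)
  then have "sgn (sin_vec v) = sgn v"
    by (simp add: sin_vec_def sgn_scaleR) (use False in \<open>simp add: sgn_div_norm\<close>)
  moreover have "arcsin (norm (sin_vec v)) = norm v"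
    using s assms order_trans[OF _ norm_ge_zero, of "- (pi/2)" v]
    by (simp add: norm_sin_vec arcsin_sin)
  ultimately show ?thesis
    using False by (simp add: arcsin_vec_def) (simp add: sgn_div_norm)
qed simp

lemma bounded_linear_differentiable:
  assumes "bounded_linear g" "f differentiable F"
  shows "(\<lambda>x. g (f x)) differentiable F"
  using bounded_linear.has_derivative[OF assms(1)] assms(2) unfolding differentiable_def by blast

lemma isCont_tendsto_nhds: "isCont f x \<Longrightarrow> (f \<longlongrightarrow> f x) (nhds x)"
  by (simp add: isCont_def tendsto_at_iff_tendsto_nhds)

text \<open>Multiplicativity of the quaternion norm, Euler's four-square identity.\<close>

lemma quat_rot_mult_unit:
  assumes "w\<^sup>2 + v \<bullet> v = 1" "w'\<^sup>2 + v' \<bullet> v' = 1"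
  shows "(w * w' - v \<bullet> v')\<^sup>2 + (w *\<^sub>R v' + w' *\<^sub>R v + cross3 v v') \<bullet> (w *\<^sub>R v' + w' *\<^sub>R v + cross3 v v') = 1"
proof -
  have "(w * w' - v \<bullet> v')\<^sup>2 + (w *\<^sub>R v' + w' *\<^sub>R v + cross3 v v') \<bullet> (w *\<^sub>R v' + w' *\<^sub>R v + cross3 v v')
     = (w\<^sup>2 + v \<bullet> v) * (w'\<^sup>2 + v' \<bullet> v')"
    by (simp add: mat3_simps power2_eq_square) algebra
  then show ?thesis using assms by simp
qed

text \<open>A quaternion and its negative give the same rotation; the sign condition on w selects
  the representative whose half angle is arcsin |v|, as cos (arcsin |v|) is the nonnegative root.
  The factor 2 passes from half angle to angle.\<close>

lemma quat_rot_eq_mat_exp: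
  assumes "w\<^sup>2 + v \<bullet> v = 1" "0 \<le> w"
  shows "quat_rot w v = mat_exp (hat (2 *\<^sub>R arcsin_vec v))"
proof -
  have w: "w\<^sup>2 = 1 - (norm v)\<^sup>2" using assms by (simp add: dot_square_norm)
  have "(norm v)\<^sup>2 \<le> 1\<^sup>2" using w zero_le_power2[of w] by simp
  then have v: "norm v \<le> 1" by (rule power2_le_imp_le) simp
  have "cos (arcsin (norm v)) = sqrt (1 - (norm v)\<^sup>2)"
    by (rule cos_arcsin) (use v norm_ge_zero[of v] in linarith)+
  also have "\<dots> = w" using assms(2) by (simp add: w[symmetric])
  finally have "cos (norm (2 *\<^sub>R arcsin_vec v) / 2) = w"
    by (simp add: norm_arcsin_vec v)
  then show ?thesis by (simp add: mat_exp_hat sin_vec_arcsin_vec v)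
qed

lemma differentiable_scale_sin_vec: "(\<lambda>v::'a::real_inner. sin_vec (c *\<^sub>R v)) differentiable (at 0)"
proof -
  have "(sin_vec :: 'a \<Rightarrow> 'a) differentiable (at (c *\<^sub>R 0))"
    using sin_vec_has_derivative_0 by (auto simp: differentiable_def)
  then have "(sin_vec \<circ> (\<lambda>v::'a. c *\<^sub>R v)) differentiable (at 0)"
    by (intro differentiable_chain_at) (auto intro!: derivative_intros)
  then show ?thesis by (simp add: o_def)
qed

text \<open>The double-angle formula trades the cosine of a norm for an inner product of
  \<open>sin_vec\<close>, which is visibly differentiable at 0. The quarter is half of the half
  angle.\<close>

lemma cos_norm_half: "cos (norm v / 2) = 1 - 2 * (sin_vec ((1/4) *\<^sub>R v) \<bullet> sin_vec ((1/4) *\<^sub>R v))"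
  using cos_double_sin[of "norm v / 4"] by (simp add: sin_vec_inner_self)

lemma bounded_linear_cross3: "bounded_linear (cross3 a)"
  by (rule linear_conv_bounded_linear[THEN iffD1])
     (auto intro!: linearI simp: mat3_simps algebra_simps)

section \<open>Transition maps between right-perturbation charts\<close>

text \<open>The quaternion product has parts \<open>w \<xi>\<close> and \<open>v \<xi>\<close>, and
  \<open>c\<close> is its logarithm. The bound |a| < pi serves twice: it makes
  \<open>w 0 = cos (|a|/2)\<close> positive, so that the logarithm formula holds near 0 by
  continuity, and it gives \<open>norm (v 0) < 1\<close>, so that \<open>arcsin_vec\<close> is
  differentiable there.\<close>

lemma mat_exp_hat_compose:
  assumes "norm a < pi"
  obtains c where "c differentiable (at 0)" "c 0 = a"
    "\<forall>\<^sub>F \<xi> in nhds 0. mat_exp (hat a) ** mat_exp (hat \<xi>) = mat_exp (hat (c \<xi>))"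
proof -
  let ?V = "\<lambda>\<xi>::real^3. sin_vec ((1/2) *\<^sub>R \<xi>)" and ?C = "\<lambda>\<xi>::real^3. cos (norm \<xi> / 2)"
  define w where "w \<xi> = ?C a * ?C \<xi> - ?V a \<bullet> ?V \<xi>" for \<xi>
  define v where "v \<xi> = ?C a *\<^sub>R ?V \<xi> + ?C \<xi> *\<^sub>R ?V a + cross3 (?V a) (?V \<xi>)" for \<xi>
  define c where "c \<xi> = 2 *\<^sub>R arcsin_vec (v \<xi>)" for \<xi>
  have dC: "?C differentiable (at 0)"
    unfolding cos_norm_half
    by (intro differentiable_diff differentiable_const differentiable_mult differentiable_inner
          differentiable_scale_sin_vec)
  have dV: "?V differentiable (at 0)"
    by (rule differentiable_scale_sin_vec)
  have dcross: "(\<lambda>\<xi>. cross3 (?V a) (?V \<xi>)) differentiable (at 0)"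
    using bounded_linear_differentiable[OF bounded_linear_cross3 dV] .
  have dw: "w differentiable (at 0)"
    unfolding w_def[abs_def]
    by (intro differentiable_diff differentiable_const differentiable_mult differentiable_inner dC dV)
  have dv: "v differentiable (at 0)"
    unfolding v_def[abs_def]
    by (intro differentiable_add differentiable_const differentiable_scaleR dC dV dcross)
  have v0: "v 0 = ?V a" by (simp add: v_def cross_zero_right)
  have "norm (v 0) < 1"
  proof -
    have "cos (norm a / 2) > 0"
      using assms norm_ge_zero[of a] pi_gt_zero by (intro cos_gt_zero_pi) linarith+
    then have "(sin (norm a / 2))\<^sup>2 < 1\<^sup>2"
      using sin_cos_squared_add[of "norm a / 2"] zero_less_power[of "cos (norm a / 2)" 2]
      unfolding one_power2 by linarith
    then have "\<bar>sin (norm a / 2)\<bar> < 1" using abs_square_less_1 by auto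
    then show ?thesis by (simp add: v0 norm_sin_vec)
  qed
  then have "(arcsin_vec \<circ> v) differentiable (at 0)"
    by (intro differentiable_chain_at dv arcsin_vec_differentiable)
  then have dc: "c differentiable (at 0)"
    unfolding c_def[abs_def] o_def by (intro differentiable_scaleR differentiable_const)
  have c0: "c 0 = a"
    using assms by (simp add: c_def v0 arcsin_vec_sin_vec)
  have "0 < w 0" using assms order_less_le_trans[OF _ norm_ge_zero, of "-pi" a] pi_gt_zero
    by (simp add: w_def cos_gt_zero_pi)
  moreover have "isCont w 0" using dw differentiable_imp_continuous_within by blast
  ultimately have "\<forall>\<^sub>F \<xi> in nhds 0. 0 < w \<xi>"
    by (metis eventually_nhds_conv_at isCont_def order_tendstoD(1))
  then have "\<forall>\<^sub>F \<xi> in nhds 0. mat_exp (hat a) ** mat_exp (hat \<xi>) = mat_exp (hat (c \<xi>))"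
  proof eventually_elim
    case (elim \<xi>)
    have "(w \<xi>)\<^sup>2 + v \<xi> \<bullet> v \<xi> = 1"
      unfolding w_def v_def by (rule quat_rot_mult_unit) (simp_all add: sin_vec_inner_self)
    moreover have "mat_exp (hat a) ** mat_exp (hat \<xi>) = quat_rot (w \<xi>) (v \<xi>)"
      unfolding mat_exp_hat quat_rot_mult w_def v_def ..
    ultimately show ?case
      using elim by (simp add: quat_rot_eq_mat_exp c_def)
  qed
  then show thesis using that dc c0 by blast
qed

lemma tendsto_matrix_matrix_mult:
  fixes A :: "real^'n^'m" and B :: "real^'k^'n"
  assumes "(f \<longlongrightarrow> A) F" "(g \<longlongrightarrow> B) F"
  shows "((\<lambda>x. f x ** g x) \<longlongrightarrow> A ** B) F"
proof (intro vec_tendstoI)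
  fix i j
  show "((\<lambda>x. (f x ** g x) $ i $ j) \<longlongrightarrow> (A ** B) $ i $ j) F"
    unfolding matrix_matrix_mult_def vec_lambda_beta
    by (intro tendsto_sum tendsto_mult tendsto_vec_nth assms)
qed

lemma hat_add: "hat (x + y) = hat x + hat y"
  by (simp add: vec_eq_iff forall_3 hat_def)
lemma bounded_linear_hat: "bounded_linear hat"
  by (intro linear_conv_bounded_linear[THEN iffD1] linearI hat_scaleR hat_add)

lemma tendsto_mat_exp_hat: "((\<lambda>\<phi>. mat_exp (hat \<phi>)) \<longlongrightarrow> mat 1) (nhds 0)"
proof -
  have "isCont (\<lambda>\<phi>::real^3. cos (norm \<phi> / 2)) 0" by (intro continuous_intros) auto
  from isCont_tendsto_nhds[OF this]
  have c: "((\<lambda>\<phi>::real^3. cos (norm \<phi> / 2)) \<longlongrightarrow> 1) (nhds 0)" by simp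
  have "isCont (\<lambda>\<phi>::real^3. sin_vec ((1/2) *\<^sub>R \<phi>)) 0"
    using differentiable_scale_sin_vec differentiable_imp_continuous_within by blast
  from isCont_tendsto_nhds[OF this]
  have v: "((\<lambda>\<phi>::real^3. sin_vec ((1/2) *\<^sub>R \<phi>)) \<longlongrightarrow> 0) (nhds 0)" by simp
  have "((\<lambda>\<phi>::real^3. hat (sin_vec ((1/2) *\<^sub>R \<phi>))) \<longlongrightarrow> 0) (nhds 0)"
    using bounded_linear.tendsto[OF bounded_linear_hat v] by simp
  note 1 = this tendsto_matrix_matrix_mult[OF this this]
  have "((\<lambda>\<phi>. quat_rot (cos (norm \<phi> / 2)) (sin_vec ((1/2) *\<^sub>R \<phi>))) \<longlongrightarrow>
      (1\<^sup>2 + 0 \<bullet> (0::real^3)) *\<^sub>R mat 1 + (2 * 1) *\<^sub>R 0 + 2 *\<^sub>R ((0::real^3^3) ** (0::real^3^3))) (nhds 0)"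
    unfolding quat_rot_def by (intro tendsto_intros 1 c v)
  then show ?thesis unfolding mat_exp_hat by simp
qed

lemma rot_part_add: "rot_part (x + y) = rot_part x + rot_part y"
  by (simp add: rot_part_def vec_eq_iff forall_3)

lemma rot_part_scaleR: "rot_part (c *\<^sub>R x) = c *\<^sub>R rot_part x"
  by (simp add: rot_part_def vec_eq_iff forall_3)

lemma bounded_linear_rot_part: "bounded_linear rot_part"
  by (intro linear_conv_bounded_linear[THEN iffD1] linearI rot_part_add rot_part_scaleR)

lemma rot_part_0 [simp]: "rot_part 0 = 0"
  by (simp add: rot_part_def vec_eq_iff forall_3)

lemma trans_part_add: "trans_part (x + y) = trans_part x + trans_part y"
  by (simp add: trans_part_def vec_eq_iff forall_3)

lemma trans_part_scaleR: "trans_part (c *\<^sub>R x) = c *\<^sub>R trans_part x"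
  by (simp add: trans_part_def vec_eq_iff forall_3)

lemma bounded_linear_trans_part: "bounded_linear trans_part"
  by (intro linear_conv_bounded_linear[THEN iffD1] linearI trans_part_add trans_part_scaleR)

lemma trans_part_0 [simp]: "trans_part 0 = 0"
  by (simp add: trans_part_def vec_eq_iff forall_3)

text \<open>A linear right inverse of \<open>rot_part\<close>, used to alter the rotation components
  of a perturbation while keeping its translation.\<close>

definition rot_embed :: "real^3 \<Rightarrow> real^6" where
  "rot_embed p = (p $ 1) *\<^sub>R axis 1 1 + (p $ 2) *\<^sub>R axis 2 1 + (p $ 3) *\<^sub>R axis 3 1"

lemma rot_part_rot_embed [simp]: "rot_part (rot_embed p) = p"
  and trans_part_rot_embed [simp]: "trans_part (rot_embed p) = 0"
  by (simp_all add: rot_embed_def rot_part_def trans_part_def vec_eq_iff forall_3 axis_def)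

lemma bounded_linear_rot_embed: "bounded_linear rot_embed"
  by (intro linear_conv_bounded_linear[THEN iffD1] linearI) (simp_all add: rot_embed_def algebra_simps)

lemma oplus_0 [simp]: "X \<oplus> 0 = X"
  by (simp add: oplus_def)

lemma oplus_in_poses: "X \<in> poses \<Longrightarrow> X \<oplus> \<xi> \<in> poses"
  using rotation_matrix_mat_exp_hat[of "rot_part \<xi>"]
  by (auto simp: poses_def oplus_def rotation_matrix_def orthogonal_matrix_mul det_mul)

lemma tendsto_oplus: "((\<lambda>\<xi>. X \<oplus> \<xi>) \<longlongrightarrow> X) (nhds 0)"
proof -
  have "(rot_part \<longlongrightarrow> 0) (nhds 0)"
    using bounded_linear.isCont[OF bounded_linear_rot_part continuous_ident, of 0]
    by (auto dest!: isCont_tendsto_nhds)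
  then have "((\<lambda>\<xi>. mat_exp (hat (rot_part \<xi>))) \<longlongrightarrow> mat 1) (nhds 0)"
    by (rule filterlim_compose[OF tendsto_mat_exp_hat])
  then have 1: "((\<lambda>\<xi>. fst X ** mat_exp (hat (rot_part \<xi>))) \<longlongrightarrow> fst X ** mat 1) (nhds 0)"
    by (intro tendsto_matrix_matrix_mult tendsto_const)
  have 2: "((\<lambda>\<xi>. snd X + trans_part \<xi>) \<longlongrightarrow> snd X + 0) (nhds 0)"
    using bounded_linear.isCont[OF bounded_linear_trans_part continuous_ident, of 0]
    by (intro tendsto_add tendsto_const) (auto dest!: isCont_tendsto_nhds)
  show ?thesis
    using tendsto_Pair[OF 1 2] by (simp add: oplus_def[abs_def])
qed

text \<open>Here \<open>c\<close> is the transition map between the charts centred at \<open>X \<oplus> a\<close> and at \<open>X\<close>. It makes being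
  an equilibrium, which is defined in the chart centred at the candidate point, a condition in one
  fixed chart.\<close>

lemma oplus_oplus:
  assumes "norm (rot_part a) < pi"
  obtains c where "c differentiable (at 0)" "c 0 = a"
    "\<forall>\<^sub>F \<xi> in nhds 0. \<forall>X. (X \<oplus> a) \<oplus> \<xi> = X \<oplus> c \<xi>"
proof -
  obtain c where dc: "c differentiable (at 0)" and c0: "c 0 = rot_part a"
    and ev: "\<forall>\<^sub>F \<phi> in nhds 0. mat_exp (hat (rot_part a)) ** mat_exp (hat \<phi>) = mat_exp (hat (c \<phi>))"
    using assms by (rule mat_exp_hat_compose)
  \<comment> \<open>Translations add, so \<open>a + \<xi>\<close> already has the right translation
    part; the embedded correction replaces its rotation part by
    \<open>c (rot_part \<xi>)\<close>.\<close>
  define d where "d \<xi> = a + \<xi> + rot_embed (c (rot_part \<xi>) - rot_part a - rot_part \<xi>)" for \<xi>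
  have dr: "rot_part differentiable (at x)" for x
    using bounded_linear_imp_differentiable[OF bounded_linear_rot_part] .
  have "(c \<circ> rot_part) differentiable (at 0)"
    using dc dr by (intro differentiable_chain_at) auto
  then have "d differentiable (at 0)"
    unfolding d_def[abs_def] o_def
    by (intro differentiable_add differentiable_const differentiable_ident
          bounded_linear_differentiable[OF bounded_linear_rot_embed] differentiable_diff dr)
  moreover have "d 0 = a"
    using linear_0[OF bounded_linear.linear[OF bounded_linear_rot_embed]] by (simp add: d_def c0)
  moreover have "(rot_part \<longlongrightarrow> 0) (nhds 0)"
    using bounded_linear.isCont[OF bounded_linear_rot_part continuous_ident, of 0]
    by (auto dest!: isCont_tendsto_nhds)
  then have "\<forall>\<^sub>F \<xi> in nhds 0. mat_exp (hat (rot_part a)) ** mat_exp (hat (rot_part \<xi>)) = mat_exp (hat (c (rot_part \<xi>)))"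
    using ev by (rule eventually_compose_filterlim[rotated])
  then have "\<forall>\<^sub>F \<xi> in nhds 0. \<forall>X. (X \<oplus> a) \<oplus> \<xi> = X \<oplus> d \<xi>"
    by eventually_elim
       (simp add: oplus_def d_def rot_part_add trans_part_add matrix_mul_assoc[symmetric])
  ultimately show thesis using that by blast
qed

section \<open>Second derivatives and implicit functions\<close>

text \<open>The mean value theorem is applied in the w direction only. It leaves a difference of two
  values of f', which the expansion of f' at the single point x turns into t f'' v plus a small
  error.\<close>

lemma second_difference_tendsto:
  fixes f :: "'a::real_normed_vector \<Rightarrow> real" and f' :: "'a \<Rightarrow> 'a \<Rightarrow>\<^sub>L real"
  assumes S: "open S" "x \<in> S"
    and f: "\<And>z. z \<in> S \<Longrightarrow> (f has_derivative blinfun_apply (f' z)) (at z)"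
    and f': "(f' has_derivative blinfun_apply f'') (at x)"
  shows "((\<lambda>t. (f (x + t *\<^sub>R v + t *\<^sub>R w) - f (x + t *\<^sub>R v) - f (x + t *\<^sub>R w) + f x) / t\<^sup>2)
           \<longlongrightarrow> f'' v w) (at_right 0)"
proof (rule tendstoI)
  fix e :: real assume e: "0 < e"
  \<comment> \<open>The expansion errors at \<open>t v + s w\<close> and at \<open>s w\<close> are
    at most e' t (|v| + |w|) and e' t |w|; evaluating at w brings another |w|. The total is e' t
    K.\<close>
  define K where "K = (norm v + 2 * norm w) * norm w"
  have K: "0 \<le> K" by (simp add: K_def)
  define e' where "e' = e / (K + 1)"
  have e': "0 < e'" "e' * K < e"
    using e K by (auto simp: e'_def field_simps)
  obtain d1 where d1: "0 < d1" "\<And>z. norm (z - x) < d1 \<Longrightarrow> norm (f' z - f' x - f'' (z - x)) \<le> e' * norm (z - x)"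
    using f' e'(1) unfolding has_derivative_at_alt by metis
  obtain d2 where d2: "0 < d2" "ball x d2 \<subseteq> S"
    using S openE by blast
  define d where "d = min d1 d2 / (norm v + norm w + 1)"
  have d: "0 < d" using d1 d2 by (auto simp: d_def add_nonneg_pos)
  have "dist ((f (x + t *\<^sub>R v + t *\<^sub>R w) - f (x + t *\<^sub>R v) - f (x + t *\<^sub>R w) + f x) / t\<^sup>2) (f'' v w) < e"
    if t: "0 < t" "t < d" for t
  proof -
    have td: "t * (norm v + norm w) < min d1 d2"
    proof -
      have "t * (norm v + norm w) \<le> t * (norm v + norm w + 1)" using t by simp
      also have "\<dots> < d * (norm v + norm w + 1)"
        using t by (intro mult_strict_right_mono) (auto simp: add_nonneg_pos)
      also have "\<dots> = min d1 d2"
        using add_nonneg_pos[of "norm v + norm w" 1] by (simp add: d_def)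
      finally show ?thesis .
    qed
    have small: "norm (b *\<^sub>R v + s *\<^sub>R w) < min d1 d2" if "0 \<le> b" "b \<le> t" "0 \<le> s" "s \<le> t" for b s
    proof -
      have "norm (b *\<^sub>R v + s *\<^sub>R w) \<le> b * norm v + s * norm w"
        using that norm_triangle_ineq[of "b *\<^sub>R v" "s *\<^sub>R w"] by simp
      also have "\<dots> \<le> t * norm v + t * norm w"
        using that by (intro add_mono mult_right_mono) auto
      finally show ?thesis using td by (simp add: distrib_left)
    qed
    have inS: "x + (b *\<^sub>R v + s *\<^sub>R w) \<in> S" if "0 \<le> b" "b \<le> t" "0 \<le> s" "s \<le> t" for b s
    proof -
      have "x + u \<in> ball x d2" if "norm u < d2" for u
        using that by (simp add: dist_norm)
      then have "x + (b *\<^sub>R v + s *\<^sub>R w) \<in> ball x d2"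
        using small[OF that] by simp
      then show ?thesis using d2(2) by blast
    qed
    \<comment> \<open>The vanishing term \<open>0 *\<^sub>R v\<close> is kept so that the facts
      about general b cover both b = t and b = 0.\<close>
    define g where "g s = f (x + (t *\<^sub>R v + s *\<^sub>R w)) - f (x + (0 *\<^sub>R v + s *\<^sub>R w))" for s
    define g' where "g' s = (f' (x + (t *\<^sub>R v + s *\<^sub>R w)) - f' (x + (0 *\<^sub>R v + s *\<^sub>R w))) w" for s
    have gder: "(g has_derivative (\<lambda>h. h * g' s)) (at s)" if s: "0 \<le> s" "s \<le> t" for s
    proof -
      have c: "((\<lambda>s. f (x + (b *\<^sub>R v + s *\<^sub>R w))) has_derivative (\<lambda>h. h * f' (x + (b *\<^sub>R v + s *\<^sub>R w)) w)) (at s)"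
        if b: "0 \<le> b" "b \<le> t" for b
      proof -
        have "((\<lambda>s. x + (b *\<^sub>R v + s *\<^sub>R w)) has_derivative (\<lambda>h. h *\<^sub>R w)) (at s)"
          by (auto intro!: derivative_eq_intros)
        from has_derivative_compose[OF this f[OF inS[OF b s]]]
        show ?thesis by (simp add: blinfun.scaleR_right)
      qed
      show ?thesis
        unfolding g_def[abs_def] g'_def
        using has_derivative_diff[OF c[of t] c[of 0]] t
        by (simp add: blinfun.diff_left right_diff_distrib)
    qed
    have "continuous_on {0..t} g"
      using has_derivative_continuous[OF gder] by (auto intro!: continuous_at_imp_continuous_on)
    then obtain s where s: "0 < s" "s < t" and "g t - g 0 = (t - 0) * g' s"
      by (rule mvt[OF t(1), of g "\<lambda>s h. h * g' s"]) (auto intro: gder)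
    then have mv: "g t - g 0 = t * g' s" by simp
    have near: "norm (f' (x + (b *\<^sub>R v + s *\<^sub>R w)) - f' x - f'' (b *\<^sub>R v + s *\<^sub>R w)) \<le> e' * (b * norm v + t * norm w)"
      if b: "0 \<le> b" "b \<le> t" for b
    proof -
      have "norm (f' (x + (b *\<^sub>R v + s *\<^sub>R w)) - f' x - f'' (b *\<^sub>R v + s *\<^sub>R w)) \<le> e' * norm (b *\<^sub>R v + s *\<^sub>R w)"
        using d1(2)[of "x + (b *\<^sub>R v + s *\<^sub>R w)"] small[of b s] b s by simp
      also have "norm (b *\<^sub>R v + s *\<^sub>R w) \<le> b * norm v + s * norm w"
        using b s norm_triangle_ineq[of "b *\<^sub>R v" "s *\<^sub>R w"] by simp
      also have "\<dots> \<le> b * norm v + t * norm w"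
        using s by (intro add_mono mult_right_mono) auto
      finally show ?thesis using e' by simp
    qed
    define A where "A = f' (x + (t *\<^sub>R v + s *\<^sub>R w)) - f' x - f'' (t *\<^sub>R v + s *\<^sub>R w)"
    define B where "B = f' (x + (0 *\<^sub>R v + s *\<^sub>R w)) - f' x - f'' (0 *\<^sub>R v + s *\<^sub>R w)"
    have "f'' (t *\<^sub>R v + s *\<^sub>R w) - f'' (0 *\<^sub>R v + s *\<^sub>R w) = t *\<^sub>R f'' v"
      by (simp add: blinfun.add_right blinfun.scaleR_right)
    moreover have "(p - r - q) - (p' - r - q') = (p - p') - (q - q')" for p q r p' q' :: "'a \<Rightarrow>\<^sub>L real"
      by (simp add: algebra_simps)
    note this[of "f' (x + (t *\<^sub>R v + s *\<^sub>R w))" "f' x" "f'' (t *\<^sub>R v + s *\<^sub>R w)"]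
    ultimately have "g' s - t * f'' v w = (A - B) w"
      by (simp only: A_def B_def g'_def blinfun.diff_left blinfun.scaleR_left real_scaleR_def)
    then have "\<bar>g' s - t * f'' v w\<bar> \<le> norm (A - B) * norm w"
      using norm_blinfun[of "A - B" w] by simp
    also have "norm (A - B) \<le> e' * (t * norm v + t * norm w) + e' * (0 * norm v + t * norm w)"
      using norm_triangle_ineq4[of A B] near[of t] near[of 0] t unfolding A_def[symmetric] B_def[symmetric]
      by linarith
    then have "norm (A - B) * norm w \<le> (e' * (t * norm v + t * norm w) + e' * (0 * norm v + t * norm w)) * norm w"
      by (rule mult_right_mono) simp
    also have "\<dots> = t * (e' * K)" by (simp add: K_def algebra_simps)
    also have "\<dots> < t * e" using e' t by simp
    finally have "\<bar>g' s - t * f'' v w\<bar> < t * e" .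
    then have "\<bar>g' s / t - f'' v w\<bar> < e"
    proof -
      have "g' s / t - f'' v w = (g' s - t * f'' v w) / t" using t by (simp add: field_simps)
      then show ?thesis
        using t \<open>\<bar>g' s - t * f'' v w\<bar> < t * e\<close> by (simp add: pos_divide_less_eq mult.commute)
    qed
    moreover have "(f (x + t *\<^sub>R v + t *\<^sub>R w) - f (x + t *\<^sub>R v) - f (x + t *\<^sub>R w) + f x) / t\<^sup>2 = g' s / t"
    proof -
      have "f (x + t *\<^sub>R v + t *\<^sub>R w) - f (x + t *\<^sub>R v) - f (x + t *\<^sub>R w) + f x = g t - g 0"
        by (simp add: g_def add.assoc)
      then show ?thesis using mv t by (simp add: power2_eq_square)
    qed
    ultimately show ?thesis by (simp add: dist_real_def)
  qed
  then show "\<forall>\<^sub>F t in at_right 0. dist ((f (x + t *\<^sub>R v + t *\<^sub>R w) - f (x + t *\<^sub>R v) - f (x + t *\<^sub>R w) + f x) / t\<^sup>2) (f'' v w) < e"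
    unfolding eventually_at_right_field using d by auto
qed

text \<open>The second difference is symmetric in \<open>v\<close> and \<open>w\<close>, hence so is its limit.\<close>

lemma second_derivative_symmetric:
  fixes f :: "'a::real_normed_vector \<Rightarrow> real" and f' :: "'a \<Rightarrow> 'a \<Rightarrow>\<^sub>L real"
  assumes "open S" "x \<in> S"
    and "\<And>z. z \<in> S \<Longrightarrow> (f has_derivative blinfun_apply (f' z)) (at z)"
    and "(f' has_derivative blinfun_apply f'') (at x)"
  shows "f'' v w = f'' w v"
proof -
  have "((\<lambda>t. (f (x + t *\<^sub>R v + t *\<^sub>R w) - f (x + t *\<^sub>R v) - f (x + t *\<^sub>R w) + f x) / t\<^sup>2)
           \<longlongrightarrow> f'' w v) (at_right 0)"
    using second_difference_tendsto[OF assms, of w v] by (simp add: algebra_simps)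
  then show ?thesis
    using second_difference_tendsto[OF assms, of v w] tendsto_unique trivial_limit_at_right_real by blast
qed

section \<open>The implicit function theorem\<close>

text \<open>The inverse function theorem is applied to F(x, p) = (G(x, p), p). If its derivative
  kills h, then the parameter part of h is 0 and \<open>inj\<close> kills the rest. The solution
  branch is the first component of the local inverse at (0, p).\<close>

lemma implicit_function:
  fixes G :: "'a::euclidean_space \<times> 'p::euclidean_space \<Rightarrow> 'a"
    and G' :: "'a \<times> 'p \<Rightarrow> ('a \<times> 'p) \<Rightarrow>\<^sub>L 'a"
  assumes S: "open S" "(x0, p0) \<in> S"
    and G: "\<And>z. z \<in> S \<Longrightarrow> (G has_derivative blinfun_apply (G' z)) (at z)"
    and cont: "continuous_on S G'"
    and zero: "G (x0, p0) = 0"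
    and inj: "\<And>h. G' (x0, p0) (h, 0) = 0 \<Longrightarrow> h = 0"
  obtains a N where "open N" "p0 \<in> N" "a p0 = x0"
    "\<And>p. p \<in> N \<Longrightarrow> a differentiable (at p) \<and> (a p, p) \<in> S \<and> G (a p, p) = 0"
proof -
  define P :: "'a \<Rightarrow>\<^sub>L ('a \<times> 'p)" where "P = Blinfun (\<lambda>h. (h, 0))"
  define Q :: "('a \<times> 'p) \<Rightarrow>\<^sub>L ('a \<times> 'p)" where "Q = Blinfun (\<lambda>h. (0, snd h))"
  have P: "blinfun_apply P h = (h, 0)" for h
    unfolding P_def by (subst bounded_linear_Blinfun_apply)
      (auto intro!: bounded_linear_Pair bounded_linear_ident bounded_linear_zero)
  have Q: "blinfun_apply Q h = (0, snd h)" for h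
    unfolding Q_def by (subst bounded_linear_Blinfun_apply)
      (auto intro!: bounded_linear_Pair bounded_linear_snd bounded_linear_zero)
  define F where "F z = (G z, snd z)" for z
  define F' where "F' z = (P o\<^sub>L G' z) + Q" for z
  have F': "blinfun_apply (F' z) h = (G' z h, snd h)" for z h
    by (simp add: F'_def blinfun.add_left P Q)
  have derF: "(F has_derivative blinfun_apply (F' z)) (at z)" if "z \<in> S" for z
    unfolding F_def[abs_def] F' by (intro has_derivative_Pair G that has_derivative_snd has_derivative_ident)
  have contF: "continuous_on S F'"
    unfolding F'_def[abs_def]
    by (intro continuous_intros cont bounded_bilinear.continuous_on[OF bounded_bilinear_blinfun_compose])
  \<comment> \<open>Injectivity yields a linear left inverse, the form in which the inverse function
    theorem receives the invertibility of the derivative.\<close>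
  have "inj (blinfun_apply (F' (x0, p0)))"
  proof (rule linear_injective_0[THEN iffD2, rule_format])
    show "linear (blinfun_apply (F' (x0, p0)))"
      by (rule bounded_linear.linear[OF blinfun.bounded_linear_right])
    fix h assume "blinfun_apply (F' (x0, p0)) h = 0"
    then have "snd h = 0" "G' (x0, p0) h = 0" by (auto simp: F' zero_prod_def)
    then show "h = 0" using inj[of "fst h"] by (cases h) (auto simp: zero_prod_def)
  qed
  then obtain g0 where g0: "linear g0" "g0 \<circ> blinfun_apply (F' (x0, p0)) = id"
    using linear_injective_left_inverse[OF bounded_linear.linear[OF blinfun.bounded_linear_right]] by blast
  have "Blinfun g0 o\<^sub>L F' (x0, p0) = id_blinfun"
    using g0 by (auto intro!: blinfun_eqI simp: bounded_linear_Blinfun_apply linear_conv_bounded_linear fun_eq_iff)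
  from inverse_function_theorem[OF S(1) derF contF S(2) this]
  obtain U' V g g' where U: "open U'" "U' \<subseteq> S" "(x0, p0) \<in> U'" and V: "open V" "F (x0, p0) \<in> V"
    and hom: "homeomorphism U' V F g"
    and g': "\<And>y. y \<in> V \<Longrightarrow> (g has_derivative (g' y)) (at y)"
    by metis
  define a where "a p = fst (g (0, p))" for p
  define N where "N = (\<lambda>p. (0, p)) -` V"
  show thesis
  proof (rule that)
    show "open N"
      unfolding N_def using V(1) by (intro open_vimage continuous_intros)
    show "p0 \<in> N" using V(2) zero by (simp add: N_def F_def)
    have "g (F (x0, p0)) = (x0, p0)" using hom U(3) homeomorphism_apply1 by blast
    then show "a p0 = x0" by (simp add: a_def F_def zero)
    fix p assume "p \<in> N"
    then have p: "(0, p) \<in> V" by (simp add: N_def)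
    have "g (0, p) \<in> U'" "F (g (0, p)) = (0, p)"
      using hom p by (auto simp: homeomorphism_def)
    then have 1: "g (0, p) \<in> S" "G (g (0, p)) = 0" "snd (g (0, p)) = p"
      using U(2) by (auto simp: F_def)
    then have "(a p, p) = g (0, p)" by (metis a_def prod.collapse)
    moreover have "((\<lambda>p. (0::'a, p)) has_derivative (\<lambda>h. (0, h))) (at p)"
      by (intro has_derivative_Pair has_derivative_const has_derivative_ident)
    from has_derivative_fst[OF has_derivative_compose[OF this g'[OF p]]]
    have "((\<lambda>p. fst (g (0, p))) has_derivative (\<lambda>h. fst (g' (0, p) (0, h)))) (at p)" .
    then have "a differentiable (at p)" unfolding a_def[abs_def] by (rule differentiableI)
    ultimately show "a differentiable (at p) \<and> (a p, p) \<in> S \<and> G (a p, p) = 0"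
      using 1 by simp
  qed
qed

section \<open>Gradients and the first-order Taylor remainder\<close>

lemma grad_nth:
  assumes "(f has_derivative f') (at x)"
  shows "grad f x $ i = f' (axis i 1)"
  using frechet_derivative_at[OF assms] by (simp add: grad_def)

text \<open>\<open>frechet_derivative\<close> is chosen from the predicate
  \<open>has_derivative\<close>, and agreement near x makes the two predicates equal. A default
  value, if any, is then shared as well.\<close>

lemma grad_cong:
  assumes "\<forall>\<^sub>F z in nhds x. f z = g z"
  shows "grad f x = grad g x"
proof -
  have "(f has_derivative D) (at x) \<longleftrightarrow> (g has_derivative D) (at x)" for D
    using assms eventually_nhds_x_imp_x[OF assms]
    by (auto elim!: has_derivative_transform_eventually
          intro: eventually_mono[OF eventually_nhds_conv_at[THEN iffD1, THEN conjunct1]])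
  then show ?thesis by (simp add: grad_def frechet_derivative_def)
qed

text \<open>Differentiability of f' at x, with tolerance 1, gives |f' z - f' x| <= (1 + |f'' x|) |z
  - x| near x. The mean value bound on the closed ball of radius |h| contributes the second factor
  |h|.\<close>

lemma C2_near_remainder:
  assumes "C2_near f x"
  shows "\<exists>C. \<forall>\<^sub>F h in nhds 0. norm (f (x + h) - f x - frechet_derivative f (at x) h) \<le> C * (norm h)\<^sup>2"
proof -
  obtain S f' f'' where S: "open S" "x \<in> S"
    and f: "\<And>z. z \<in> S \<Longrightarrow> (f has_derivative blinfun_apply (f' z)) (at z)"
    and f': "\<And>z. z \<in> S \<Longrightarrow> (f' has_derivative blinfun_apply (f'' z)) (at z)"
    using assms unfolding C2_near_def by blast
  obtain d1 where d1: "0 < d1" "\<And>z. norm (z - x) < d1 \<Longrightarrow> norm (f' z - f' x - f'' x (z - x)) \<le> 1 * norm (z - x)"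
    using f'[OF S(2)] unfolding has_derivative_at_alt by (metis zero_less_one)
  obtain d2 where d2: "0 < d2" "ball x d2 \<subseteq> S"
    using S openE by blast
  define C where "C = 1 + norm (f'' x)"
  have "norm (f (x + h) - f x - frechet_derivative f (at x) h) \<le> C * (norm h)\<^sup>2"
    if h: "norm h < min d1 d2" for h
  proof -
    have lip: "norm (f' z - f' x) \<le> C * norm h" if z: "z \<in> cball x (norm h)" for z
    proof -
      have zh: "norm (z - x) \<le> norm h" using z by (simp add: dist_norm norm_minus_commute)
      have "norm (f' z - f' x) \<le> norm (f' z - f' x - f'' x (z - x)) + norm (f'' x (z - x))"
        using norm_triangle_ineq[of "f' z - f' x - f'' x (z - x)" "f'' x (z - x)"] by simp
      also have "\<dots> \<le> norm (z - x) + norm (f'' x) * norm (z - x)"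
        using d1(2)[of z] zh h norm_blinfun[of "f'' x" "z - x"] by (intro add_mono) auto
      also have "\<dots> = C * norm (z - x)" by (simp add: C_def algebra_simps)
      also have "\<dots> \<le> C * norm h" using zh by (intro mult_left_mono) (auto simp: C_def)
      finally show ?thesis .
    qed
    have sub: "cball x (norm h) \<subseteq> S" using h d2 by (auto simp: subset_iff)
    have "norm (f (x + h) - f x - f' x (x + h - x)) \<le> norm (x + h - x) * (C * norm h)"
    proof (rule differentiable_bound_linearization[where S="cball x (norm h)" and f'="\<lambda>z. blinfun_apply (f' z)"])
      show "x + t *\<^sub>R (x + h - x) \<in> cball x (norm h)" if "t \<in> {0..1}" for t
        using that by (simp add: dist_norm mult_left_le_one_le)
      show "(f has_derivative blinfun_apply (f' z)) (at z within cball x (norm h))"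
        if "z \<in> cball x (norm h)" for z
        using f sub that has_derivative_at_withinI by blast
      show "onorm (blinfun_apply (f' z) - blinfun_apply (f' x)) \<le> C * norm h"
        if "z \<in> cball x (norm h)" for z
        using lip[OF that] by (simp add: norm_blinfun.rep_eq blinfun.diff_left fun_diff_def minus_blinfun.rep_eq)
    qed simp
    then show ?thesis
      using frechet_derivative_at[OF f[OF S(2)]] by (simp add: power2_eq_square ac_simps)
  qed
  moreover have "\<forall>\<^sub>F h in nhds (0::'a). norm h < min d1 d2"
    using d1 d2 eventually_nhds_metric[of "\<lambda>h. norm h < min d1 d2" 0]
    by (metis dist_norm diff_zero min_less_iff_conj)
  ultimately show ?thesis
    by (intro exI[of _ C]) (auto elim: eventually_mono)
qed

section \<open>The gradient of the reduced potential\<close>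

lemma bounded_linear_slot [simp]: "bounded_linear slotA" "bounded_linear slotU" "bounded_linear slotB"
  unfolding slotA_def[abs_def] slotU_def[abs_def] slotB_def[abs_def]
  by (intro bounded_linear_Pair bounded_linear_ident bounded_linear_zero)+

lemma partial_grad_nth:
  assumes "bounded_linear \<alpha>" "(F has_derivative F') (at z)"
  shows "partial_grad \<alpha> F z $ j = F' (\<alpha> (axis j 1))"
proof -
  have "\<alpha> 0 = 0" using assms(1) by (simp add: linear_0 bounded_linear.linear)
  have "((\<lambda>\<xi>. z + \<alpha> \<xi>) has_derivative (\<lambda>h. 0 + \<alpha> h)) (at 0)"
    by (intro has_derivative_add has_derivative_const bounded_linear_imp_has_derivative assms)
  then have "((\<lambda>\<xi>. F (z + \<alpha> \<xi>)) has_derivative (\<lambda>h. F' (\<alpha> h))) (at 0)"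
    using has_derivative_compose[of "\<lambda>\<xi>. z + \<alpha> \<xi>" \<alpha> 0 UNIV F F'] assms(2) \<open>\<alpha> 0 = 0\<close> by simp
  then show ?thesis unfolding partial_grad_def by (rule grad_nth)
qed

text \<open>\<open>hess_block\<close> with the poses stripped off, so that the analysis can take
  place entirely in a vector space.\<close>

definition hessian ::
  "(real^6 \<Rightarrow> (real^6) \<times> (real^6) \<times> (real^6)) \<Rightarrow> (real^6 \<Rightarrow> (real^6) \<times> (real^6) \<times> (real^6))
    \<Rightarrow> ((real^6) \<times> (real^6) \<times> (real^6) \<Rightarrow> real) \<Rightarrow> real^6^6" where
  "hessian \<alpha> \<beta> F = (\<chi> i j. partial_grad \<alpha> (\<lambda>z. partial_grad \<beta> F z $ j) 0 $ i)"

lemma hess_block_eq_hessian: "hess_block \<alpha> \<beta> W X = hessian \<alpha> \<beta> (in_coords W X)"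
  by (simp add: hess_block_def hessian_def)

text \<open>The order of differentiation is recorded: the outer derivative (rows, \<alpha>) fills
  the first argument of \<open>F''\<close>, the inner one (columns, \<beta>) the second.\<close>

lemma hessian_mult_vec:
  fixes F' :: "_ \<Rightarrow> _ \<Rightarrow>\<^sub>L real"
  assumes S: "open S" "0 \<in> S" and lin: "bounded_linear \<alpha>" "bounded_linear \<beta>"
    and F: "\<And>z. z \<in> S \<Longrightarrow> (F has_derivative blinfun_apply (F' z)) (at z)"
    and F': "(F' has_derivative blinfun_apply F'') (at 0)"
  shows "(hessian \<alpha> \<beta> F *v h) $ i = F'' (\<alpha> (axis i 1)) (\<beta> h)"
proof -
  have "hessian \<alpha> \<beta> F $ i $ j = F'' (\<alpha> (axis i 1)) (\<beta> (axis j 1))" for j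
  proof -
    have "((\<lambda>z. F' z (\<beta> (axis j 1))) has_derivative (\<lambda>h. F'' h (\<beta> (axis j 1)))) (at 0)"
      using bounded_linear.has_derivative[OF blinfun.bounded_linear_left F'] .
    then have "((\<lambda>z. partial_grad \<beta> F z $ j) has_derivative (\<lambda>h. F'' h (\<beta> (axis j 1)))) (at 0)"
      by (rule has_derivative_transform_within_open[OF _ S]) (simp add: partial_grad_nth[OF lin(2) F])
    from partial_grad_nth[OF lin(1) this] show ?thesis by (simp add: hessian_def)
  qed
  then have "(hessian \<alpha> \<beta> F *v h) $ i = (\<Sum>j\<in>UNIV. F'' (\<alpha> (axis i 1)) (\<beta> (axis j 1)) * h $ j)"
    by (simp add: matrix_vector_mult_def)
  also have "\<dots> = F'' (\<alpha> (axis i 1)) (\<beta> (\<Sum>j\<in>UNIV. h $ j *\<^sub>R axis j 1))"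
    by (simp add: linear_sum[OF bounded_linear.linear[OF lin(2)]]
          linear_scale[OF bounded_linear.linear[OF lin(2)]] blinfun.sum_right blinfun.scaleR_right mult.commute)
  also have "(\<Sum>j\<in>UNIV. h $ j *\<^sub>R axis j 1) = h"
    using basis_expansion[of h] by (simp add: scalar_mult_eq_scaleR)
  finally show ?thesis .
qed

lemma matrix_inv:
  fixes A :: "'a::semiring_1^'n^'m"
  assumes "invertible A"
  shows matrix_inv_right: "A ** matrix_inv A = mat 1" and matrix_inv_left: "matrix_inv A ** A = mat 1"
  using someI_ex[OF assms[unfolded invertible_def]] by (simp_all add: matrix_inv_def)

lemma matrix_inv_unique:
  fixes A :: "'a::semiring_1^'n^'m"
  assumes "A ** B = mat 1" "B ** A = mat 1"
  shows "matrix_inv A = B"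
proof -
  have "invertible A" using assms unfolding invertible_def by blast
  then have "matrix_inv A ** (A ** B) = B"
    by (simp add: matrix_mul_assoc matrix_inv_left)
  then show ?thesis using assms(1) by simp
qed

lemma matrix_vector_mult_minus_right: "A *v (- x) = - (A *v x)" for A :: "real^'n^'m"
  by (rule linear_neg[OF matrix_vector_mul_linear])

text \<open>Here p = (u, b). The branch \<open>a\<close> and its criticality are handed out with the
  derivative, since they are what later identifies \<open>a\<close> with the equilibrium
  map.\<close>

lemma reduced_gradient_derivative:
  fixes F :: "(real^6) \<times> (real^6) \<times> (real^6) \<Rightarrow> real"
  assumes C2: "C2_near F 0"
    and crit: "partial_grad slotA F 0 = 0"
    and inv: "invertible (hessian slotA slotA F)"
  obtains a N where "open N" "0 \<in> N" "a 0 = 0" "\<And>p. p \<in> N \<Longrightarrow> a differentiable (at p)"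
    "\<And>p. p \<in> N \<Longrightarrow> \<exists>D. (F has_derivative D) (at (a p, p)) \<and> (\<forall>h. D (slotA h) = 0)"
    "((\<lambda>b. grad (\<lambda>u. F (a (u, b), u, b)) 0) has_derivative
       (\<lambda>h. (hessian slotU slotB F
              - hessian slotU slotA F ** matrix_inv (hessian slotA slotA F) ** hessian slotA slotB F) *v h)) (at 0)"
proof -
  let ?H = "\<lambda>\<alpha> \<beta>. hessian \<alpha> \<beta> F"
  obtain S F' F'' where S: "open S" "0 \<in> S"
    and F: "\<And>z. z \<in> S \<Longrightarrow> (F has_derivative blinfun_apply (F' z)) (at z)"
    and F': "\<And>z. z \<in> S \<Longrightarrow> (F' has_derivative blinfun_apply (F'' z)) (at z)"
    and contF'': "continuous_on S F''"
    using C2 unfolding C2_near_def by blast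
  have sym: "F'' 0 v w = F'' 0 w v" for v w
    using second_derivative_symmetric[OF S F F'[OF S(2)]] .
  \<comment> \<open>Differentiating \<open>F'\<close> along a path puts the path direction first and
    the row direction last; symmetry brings the Hessian blocks into that order.\<close>
  have Hmv: "(?H \<alpha> \<beta> *v h) $ i = F'' 0 (\<beta> h) (\<alpha> (axis i 1))"
    if "bounded_linear \<alpha>" "bounded_linear \<beta>" for \<alpha> \<beta> h i
    using hessian_mult_vec[OF S that F F'[OF S(2)]] sym by simp
  \<comment> \<open>The gradient vector of a functional in the \<beta> slot. Being linear in the
    functional, it commutes with differentiation, both for the equilibrium equation
    (\<open>slotA\<close>) and for the u gradient (\<open>slotU\<close>).\<close>
  define T where "T \<beta> \<phi> = (\<Sum>j\<in>UNIV. blinfun_apply \<phi> (\<beta> (axis j 1)) *\<^sub>R (axis j 1 :: real^6))"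
    for \<beta> :: "real^6 \<Rightarrow> (real^6) \<times> (real^6) \<times> (real^6)" and \<phi> :: "((real^6) \<times> (real^6) \<times> (real^6)) \<Rightarrow>\<^sub>L real"
  have T: "bounded_linear (T \<beta>)" for \<beta>
    unfolding T_def[abs_def]
    by (intro bounded_linear_sum bounded_linear_compose[OF bounded_linear_scaleR_left]
          blinfun.bounded_linear_left)
  have T_nth: "T \<beta> \<phi> $ i = \<phi> (\<beta> (axis i 1))" for \<beta> \<phi> i
    unfolding T_def by (simp add: axis_def if_distrib cong: if_cong)
  have F'_slotA: "F' z (slotA h) = T slotA (F' z) \<bullet> h" for z h
  proof -
    have "h = (\<Sum>j\<in>UNIV. h $ j *\<^sub>R axis j 1)"
      using basis_expansion[of h] by (simp add: scalar_mult_eq_scaleR)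
    then have "F' z (slotA h) = F' z (slotA (\<Sum>j\<in>UNIV. h $ j *\<^sub>R axis j 1))" by simp
    also have "\<dots> = T slotA (F' z) \<bullet> h"
      by (simp add: linear_sum[OF bounded_linear.linear[OF bounded_linear_slot(1)]]
          linear_scale[OF bounded_linear.linear[OF bounded_linear_slot(1)]] blinfun.sum_right
          blinfun.scaleR_right T_nth inner_vec_def mult.commute)
    finally show ?thesis .
  qed
  define G where "G z = T slotA (F' z)" for z
  define G' where "G' z = Blinfun (T slotA) o\<^sub>L F'' z" for z
  have G'_apply: "G' z h = T slotA (F'' z h)" for z h
    by (simp add: G'_def bounded_linear_Blinfun_apply[OF T])
  obtain a N where N: "open N" "0 \<in> N" and a0: "a 0 = 0"
    and a: "\<And>p. p \<in> N \<Longrightarrow> a differentiable (at p) \<and> (a p, p) \<in> S \<and> G (a p, p) = 0"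
  proof (rule implicit_function[of S 0 0 G G'])
    show "open S" "(0, 0) \<in> S" using S by (simp_all add: zero_prod_def)
    show "(G has_derivative blinfun_apply (G' z)) (at z)" if "z \<in> S" for z
      unfolding G_def[abs_def] G'_apply by (rule bounded_linear.has_derivative[OF T F'[OF that]])
    show "continuous_on S G'"
      unfolding G'_def[abs_def]
      by (intro bounded_bilinear.continuous_on[OF bounded_bilinear_blinfun_compose] continuous_on_const contF'')
    show "G (0, 0) = 0"
      using partial_grad_nth[OF bounded_linear_slot(1) F[OF S(2)]] crit
      by (simp add: G_def vec_eq_iff T_nth zero_prod_def)
    fix h assume "G' (0, 0) (h, 0) = 0"
    then have "T slotA (F'' 0 (slotA h)) = 0"
      by (simp add: G'_apply slotA_def zero_prod_def)
    then have "?H slotA slotA *v h = 0"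
      by (simp add: vec_eq_iff Hmv T_nth)
    then show "h = 0"
      using inv unfolding invertible_left_inverse matrix_left_invertible_ker by blast
  qed blast
  have crit_a: "\<exists>D. (F has_derivative D) (at (a p, p)) \<and> (\<forall>h. D (slotA h) = 0)" if "p \<in> N" for p
  proof (intro exI conjI allI)
    show "(F has_derivative blinfun_apply (F' (a p, p))) (at (a p, p))"
      using F a[OF that] by blast
    show "F' (a p, p) (slotA h) = 0" for h
      using a[OF that] by (simp add: F'_slotA G_def)
  qed
  obtain a' where a': "(a has_derivative a') (at 0)"
    using a[OF N(2)] by (auto simp: differentiable_def)
  have embed: "((\<lambda>b. (0, b)) has_derivative (\<lambda>h. (0, h))) (at b)" for b :: "real^6"
    by (intro has_derivative_Pair has_derivative_const has_derivative_ident)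
  have zero3: "(0, 0) = (0 :: (real^6) \<times> (real^6))" "(0, 0) = (0 :: (real^6) \<times> (real^6) \<times> (real^6))"
    by (simp_all add: zero_prod_def)
  have path: "((\<lambda>b. (a (0, b), (0, b))) has_derivative (\<lambda>h. (a' (0, h), (0, h)))) (at 0)"
    using has_derivative_compose[OF embed, of a a' 0] a'
    by (intro has_derivative_Pair embed) (simp add: zero3)
  have F'path: "((\<lambda>b. T \<beta> (F' (a (0, b), (0, b)))) has_derivative (\<lambda>h. ?H \<beta> slotA *v a' (0, h) + ?H \<beta> slotB *v h)) (at 0)"
    if \<beta>: "bounded_linear \<beta>" for \<beta>
  proof -
    have "((\<lambda>b. F' (a (0, b), (0, b))) has_derivative (\<lambda>h. F'' 0 (a' (0, h), (0, h)))) (at 0)"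
      using has_derivative_compose[OF path, of F' "F'' 0"] F'[OF S(2)] by (simp add: zero3 a0)
    from bounded_linear.has_derivative[OF T[of \<beta>] this]
    moreover have "T \<beta> (F'' 0 (a' (0, h), (0, h))) = ?H \<beta> slotA *v a' (0, h) + ?H \<beta> slotB *v h" for h
    proof -
      have "(a' (0, h), (0, h)) = slotA (a' (0, h)) + slotB h"
        by (simp add: slotA_def slotB_def)
      then show ?thesis
        by (simp add: vec_eq_iff T_nth Hmv \<beta> blinfun.add_left blinfun.add_right)
    qed
    ultimately show ?thesis by simp
  qed
  have evN: "\<forall>\<^sub>F b in nhds 0. (0, b) \<in> N"
  proof -
    have "open ((\<lambda>b::real^6. (0::real^6, b)) -` N)" using N(1) by (intro open_vimage continuous_intros)
    moreover have "0 \<in> (\<lambda>b::real^6. (0::real^6, b)) -` N" using N(2) by (simp add: zero3)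
    ultimately show ?thesis by (auto simp: eventually_nhds)
  qed
  \<comment> \<open>The equilibrium equation holds identically in b, so its derivative is 0;
    comparison with the chain rule gives the linear equation for the derivative of
    \<open>a\<close>.\<close>
  have "((\<lambda>b. T slotA (F' (a (0, b), (0, b)))) has_derivative (\<lambda>h. 0)) (at 0)"
  proof (rule has_derivative_transform_eventually[OF has_derivative_const[of 0]])
    show "\<forall>\<^sub>F b in at 0. 0 = T slotA (F' (a (0, b), 0, b))"
      using evN a unfolding eventually_at_filter G_def by (auto elim: eventually_mono)
    show "0 = T slotA (F' (a (0, 0), 0, 0))"
      using a[OF N(2)] by (simp add: G_def zero3)
  qed simp
  from has_derivative_unique[OF this F'path[OF bounded_linear_slot(1)]]
  have sol: "?H slotA slotA *v a' (0, h) + ?H slotA slotB *v h = 0" for h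
    by metis
  have a'_eq: "a' (0, h) = - (matrix_inv (?H slotA slotA) *v (?H slotA slotB *v h))" for h
  proof -
    have "?H slotA slotA *v a' (0, h) = - (?H slotA slotB *v h)"
      using sol by (simp add: eq_neg_iff_add_eq_0)
    then have "matrix_inv (?H slotA slotA) *v (?H slotA slotA *v a' (0, h)) = - (matrix_inv (?H slotA slotA) *v (?H slotA slotB *v h))"
      by (simp add: matrix_vector_mult_minus_right)
    then show ?thesis
      by (simp add: matrix_vector_mul_assoc matrix_inv_left[OF inv])
  qed
  \<comment> \<open>The derivative \<open>D\<close> of \<open>a\<close> enters only through the A
    slot, where \<open>F'\<close> vanishes on the branch.\<close>
  have envelope: "grad (\<lambda>u. F (a (u, b), u, b)) 0 = T slotU (F' (a (0, b), (0, b)))" if b: "(0, b) \<in> N" for b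
  proof -
    obtain D where D: "(a has_derivative D) (at (0, b))"
      using a[OF b] by (auto simp: differentiable_def)
    have e: "((\<lambda>u. (u, b)) has_derivative (\<lambda>h. (h, 0))) (at 0)"
      by (intro has_derivative_Pair has_derivative_const has_derivative_ident)
    have "((\<lambda>u. (a (u, b), (u, b))) has_derivative (\<lambda>h. (D (h, 0), (h, 0)))) (at 0)"
      by (intro has_derivative_Pair[OF has_derivative_compose[OF e D]] e)
    from has_derivative_compose[OF this F] a[OF b]
    have "((\<lambda>u. F (a (u, b), u, b)) has_derivative (\<lambda>h. F' (a (0, b), 0, b) (D (h, 0), h, 0))) (at 0)"
      by simp
    note gr = grad_nth[OF this]
    have "F' (a (0, b), 0, b) (D (h, 0), h, 0) = F' (a (0, b), 0, b) (slotU h)" for h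
    proof -
      have "(D (h, 0), h, 0) = slotA (D (h, 0)) + slotU h" by (simp add: slotA_def slotU_def)
      moreover have "F' (a (0, b), 0, b) (slotA (D (h, 0))) = 0"
        using a[OF b] by (simp add: F'_slotA G_def)
      ultimately show ?thesis by (simp add: blinfun.add_right)
    qed
    then show ?thesis by (simp add: vec_eq_iff gr T_nth)
  qed
  have "((\<lambda>b. grad (\<lambda>u. F (a (u, b), u, b)) 0) has_derivative (\<lambda>h. ?H slotU slotA *v a' (0, h) + ?H slotU slotB *v h)) (at 0)"
  proof (rule has_derivative_transform_eventually[OF F'path[OF bounded_linear_slot(2)]])
    show "\<forall>\<^sub>F b in at 0. T slotU (F' (a (0, b), 0, b)) = grad (\<lambda>u. F (a (u, b), u, b)) 0"
      using evN envelope unfolding eventually_at_filter by (auto elim: eventually_mono)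
    show "T slotU (F' (a (0, 0), 0, 0)) = grad (\<lambda>u. F (a (u, 0), u, 0)) 0"
      using envelope[of 0] N(2) by (simp add: zero3)
  qed simp
  moreover have "?H slotU slotA *v a' (0, h) + ?H slotU slotB *v h =
      (?H slotU slotB - ?H slotU slotA ** matrix_inv (?H slotA slotA) ** ?H slotA slotB) *v h" for h
    by (simp add: a'_eq matrix_vector_mult_minus_right matrix_vector_mult_diff_rdistrib matrix_vector_mul_assoc[symmetric])
  ultimately show thesis
    using that[OF N a0 _ crit_a] a by simp
qed

section \<open>From the fixed chart back to poses\<close>

text \<open>In the chart centred at \<open>X \<oplus> a\<close> the function is the old one composed
  with the transition map, so its derivative factors through D = 0.\<close>

lemma critical_point_oplus:
  assumes F: "((\<lambda>\<xi>. f (X \<oplus> \<xi>)) has_derivative D) (at a)"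
    and D: "\<And>h. D h = 0" and a: "norm (rot_part a) < pi"
  shows "grad (\<lambda>\<xi>. f (X \<oplus> a \<oplus> \<xi>)) 0 = 0"
proof -
  obtain c where c: "c differentiable (at 0)" "c 0 = a"
    and ev: "\<forall>\<^sub>F \<xi> in nhds 0. \<forall>X. (X \<oplus> a) \<oplus> \<xi> = X \<oplus> c \<xi>"
    using a by (rule oplus_oplus)
  obtain c' where c': "(c has_derivative c') (at 0)"
    using c(1) by (auto simp: differentiable_def)
  have "((\<lambda>\<xi>. f (X \<oplus> c \<xi>)) has_derivative (\<lambda>h. D (c' h))) (at 0)"
    using has_derivative_compose[OF c', of "\<lambda>\<xi>. f (X \<oplus> \<xi>)" D] F c(2) by simp
  note gr = grad_nth[OF this]
  have "grad (\<lambda>\<xi>. f (X \<oplus> a \<oplus> \<xi>)) 0 = grad (\<lambda>\<xi>. f (X \<oplus> c \<xi>)) 0"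
    using ev by (intro grad_cong) (erule eventually_mono, metis)
  then show ?thesis by (simp add: vec_eq_iff gr D)
qed

text \<open>For small p the pose \<open>?XA \<oplus> a p\<close> is an equilibrium inside the fixed
  set \<open>V\<close>, so it must be the one picked by \<open>XAs\<close>. Near the nominal
  parameters the reduced potential is thus \<open>F (a p, p)\<close>, although nothing about the
  continuity of \<open>XAs\<close> was assumed.\<close>

lemma reduced_gradient_has_derivative:
  assumes reg: "regular_potential \<Omega> W XAs"
    and XU: "XU \<in> poses" and XB: "XB \<in> poses"
    and X: "X = (XAs (XU, XB), XU, XB)" and X_in: "X \<in> \<Omega>"
  shows "((\<lambda>b. grad (\<lambda>u. reduced_potential W XAs (XU \<oplus> u, XB \<oplus> b)) 0) has_derivative
     (\<lambda>h. (hess_block slotU slotB W X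
            - hess_block slotU slotA W X ** matrix_inv (hess_block slotA slotA W X)
              ** hess_block slotA slotB W X) *v h)) (at 0)"
proof -
  let ?XA = "XAs (XU, XB)"
  define F where "F = in_coords W X"
  have F_eq: "F (x, u, b) = W (?XA \<oplus> x, XU \<oplus> u, XB \<oplus> b)" for x u b
    by (simp add: F_def in_coords_def X)
  have param: "(XU, XB) \<in> snd ` \<Omega>" using X_in X by force
  have crit: "?XA \<in> equilibria \<Omega> W XU XB"
    and inv: "invertible (hess_block slotA slotA W X)"
    and uniq: "\<exists>V N. openin (top_of_set poses) V \<and> ?XA \<in> V \<and>
               openin (top_of_set (poses \<times> poses)) N \<and> (XU, XB) \<in> N \<and>
               (\<forall>(XU', XB') \<in> N. V \<inter> equilibria \<Omega> W XU' XB' = {XAs (XU', XB')})"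
  proof -
    have "\<forall>(XU, XB) \<in> snd ` \<Omega>.
        XAs (XU, XB) \<in> equilibria \<Omega> W XU XB \<and>
        (\<exists>V N. openin (top_of_set poses) V \<and> XAs (XU, XB) \<in> V \<and>
               openin (top_of_set (poses \<times> poses)) N \<and> (XU, XB) \<in> N \<and>
               (\<forall>(XU', XB') \<in> N. V \<inter> equilibria \<Omega> W XU' XB' = {XAs (XU', XB')})) \<and>
        invertible (hess_block slotA slotA W (XAs (XU, XB), XU, XB))"
      using reg unfolding regular_potential_def by (elim conjE)
    from bspec[OF this param]
    show "?XA \<in> equilibria \<Omega> W XU XB" "invertible (hess_block slotA slotA W X)"
      "\<exists>V N. openin (top_of_set poses) V \<and> ?XA \<in> V \<and>
               openin (top_of_set (poses \<times> poses)) N \<and> (XU, XB) \<in> N \<and>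
               (\<forall>(XU', XB') \<in> N. V \<inter> equilibria \<Omega> W XU' XB' = {XAs (XU', XB')})"
      unfolding X by (simp_all only: prod.case)
  qed
  then obtain V0 N0 where V0: "openin (top_of_set poses) V0" "?XA \<in> V0"
    and N0: "openin (top_of_set (poses \<times> poses)) N0" "(XU, XB) \<in> N0"
    and unique0: "\<And>p. p \<in> N0 \<Longrightarrow> (case p of (XU', XB') \<Rightarrow> V0 \<inter> equilibria \<Omega> W XU' XB' = {XAs (XU', XB')})"
    by blast
  obtain V where V: "open V" "V0 = poses \<inter> V" using V0(1) unfolding openin_open by blast
  obtain N where N: "open N" "N0 = (poses \<times> poses) \<inter> N" using N0(1) unfolding openin_open by blast
  have unique: "poses \<inter> V \<inter> equilibria \<Omega> W XU' XB' = {XAs (XU', XB')}"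
    if "(XU', XB') \<in> (poses \<times> poses) \<inter> N" for XU' XB'
    using unique0[of "(XU', XB')"] that unfolding V(2) N(2) by simp
  have VN_in: "?XA \<in> V" "(XU, XB) \<in> N" using V0(2) N0(2) unfolding V(2) N(2) by simp_all
  obtain O' where O: "open O'" "\<Omega> = (poses \<times> poses \<times> poses) \<inter> O'"
    using reg unfolding regular_potential_def openin_open by blast
  have XA: "?XA \<in> poses" using X_in O X by auto
  have "C2_near F 0"
    using reg X_in unfolding regular_potential_def F_def by blast
  moreover have "partial_grad slotA F 0 = 0"
    using crit by (simp add: partial_grad_def equilibria_def slotA_def F_eq zero_prod_def)
  moreover have "invertible (hessian slotA slotA F)"
    using inv by (simp add: hess_block_eq_hessian F_def)
  ultimately obtain a M where M: "open M" "0 \<in> M" and a0: "a 0 = 0"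
    and a_diff: "\<And>p. p \<in> M \<Longrightarrow> a differentiable (at p)"
    and a_crit: "\<And>p. p \<in> M \<Longrightarrow> \<exists>D. (F has_derivative D) (at (a p, p)) \<and> (\<forall>h. D (slotA h) = 0)"
    and deriv: "((\<lambda>b. grad (\<lambda>u. F (a (u, b), u, b)) 0) has_derivative
       (\<lambda>h. (hessian slotU slotB F
              - hessian slotU slotA F ** matrix_inv (hessian slotA slotA F) ** hessian slotA slotB F) *v h)) (at 0)"
    by (rule reduced_gradient_derivative) blast
  have a_lim: "(a \<longlongrightarrow> 0) (nhds 0)"
    using isCont_tendsto_nhds[OF differentiable_imp_continuous_within[OF a_diff[OF M(2)]]] a0 by simp
  have XA_lim: "((\<lambda>p. ?XA \<oplus> a p) \<longlongrightarrow> ?XA) (nhds 0)"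
    by (rule filterlim_compose[OF tendsto_oplus a_lim])
  have "(fst \<longlongrightarrow> 0) (nhds (0 :: (real^6) \<times> (real^6)))" "(snd \<longlongrightarrow> 0) (nhds (0 :: (real^6) \<times> (real^6)))"
    using isCont_tendsto_nhds[OF isCont_fst[OF continuous_ident], of "0 :: (real^6) \<times> (real^6)"]
      isCont_tendsto_nhds[OF isCont_snd[OF continuous_ident], of "0 :: (real^6) \<times> (real^6)"] by simp_all
  then have UB_lim: "((\<lambda>p. XU \<oplus> fst p) \<longlongrightarrow> XU) (nhds (0 :: (real^6) \<times> (real^6)))"
      "((\<lambda>p. XB \<oplus> snd p) \<longlongrightarrow> XB) (nhds (0 :: (real^6) \<times> (real^6)))"
    by (auto intro: filterlim_compose[OF tendsto_oplus])
  \<comment> \<open>Respectively: uniqueness applies to the candidate, uniqueness applies to the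
    parameters, the triple stays in \<Omega> as \<open>equilibria\<close> demands, and the branch is
    critical.\<close>
  have ev: "\<forall>\<^sub>F p in nhds 0. ?XA \<oplus> a p \<in> V" "\<forall>\<^sub>F p in nhds 0. (XU \<oplus> fst p, XB \<oplus> snd p) \<in> N"
    "\<forall>\<^sub>F p in nhds 0. (?XA \<oplus> a p, XU \<oplus> fst p, XB \<oplus> snd p) \<in> O'" "\<forall>\<^sub>F p in nhds 0. p \<in> M"
    using topological_tendstoD[OF XA_lim V(1) VN_in(1)] topological_tendstoD[OF tendsto_Pair[OF UB_lim] N(1) VN_in(2)]
      topological_tendstoD[OF tendsto_Pair[OF XA_lim tendsto_Pair[OF UB_lim]] O(1)] X_in O(2) X M
    by (auto intro: eventually_nhds_in_open)
  have "((\<lambda>p. norm (rot_part (a p))) \<longlongrightarrow> 0) (nhds 0)"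
    using tendsto_norm[OF bounded_linear.tendsto[OF bounded_linear_rot_part a_lim]] by simp
  then have "\<forall>\<^sub>F p in nhds 0. norm (rot_part (a p)) < pi"
    using pi_gt_zero by (rule order_tendstoD)
  with ev have "\<forall>\<^sub>F p in nhds 0. reduced_potential W XAs (XU \<oplus> fst p, XB \<oplus> snd p) = F (a p, p)"
  proof eventually_elim
    case (elim p)
    let ?U = "XU \<oplus> fst p" and ?B = "XB \<oplus> snd p"
    obtain D where D: "(F has_derivative D) (at (a p, p))" "\<And>h. D (slotA h) = 0"
      using a_crit elim(4) by blast
    have "((\<lambda>\<xi>. (\<xi>, p)) has_derivative slotA) (at (a p))"
      unfolding slotA_def[abs_def] zero_prod_def[symmetric]
      by (intro has_derivative_Pair has_derivative_const has_derivative_ident)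
    from has_derivative_compose[OF this D(1)]
    have "((\<lambda>\<xi>. W (?XA \<oplus> \<xi>, ?U, ?B)) has_derivative (\<lambda>h. D (slotA h))) (at (a p))"
      using F_eq[of _ "fst p" "snd p"] by simp
    from critical_point_oplus[OF this D(2) elim(5)]
    have "?XA \<oplus> a p \<in> equilibria \<Omega> W ?U ?B"
      using elim(3) XA XU XB by (simp add: equilibria_def O(2) oplus_in_poses)
    moreover have "(?U, ?B) \<in> (poses \<times> poses) \<inter> N"
      using elim(2) XU XB by (simp add: oplus_in_poses)
    then have "poses \<inter> V \<inter> equilibria \<Omega> W ?U ?B = {XAs (?U, ?B)}" by (rule unique)
    ultimately have "?XA \<oplus> a p \<in> {XAs (?U, ?B)}"
      using elim(1) oplus_in_poses[OF XA, of "a p"] by (metis IntI)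
    then have "XAs (?U, ?B) = ?XA \<oplus> a p" by simp
    then show ?case
      using F_eq[of "a p" "fst p" "snd p"] by (simp add: reduced_potential_def)
  qed
  \<comment> \<open>For each small b the gradients in u agree if the functions agree on a
    neighbourhood in u; slices of the open set \<open>Q\<close> provide these.\<close>
  then obtain Q where Q: "open Q" "0 \<in> Q"
    "\<And>p. p \<in> Q \<Longrightarrow> reduced_potential W XAs (XU \<oplus> fst p, XB \<oplus> snd p) = F (a p, p)"
    unfolding eventually_nhds by blast
  have eq: "grad (\<lambda>u. F (a (u, b), u, b)) 0 = grad (\<lambda>u. reduced_potential W XAs (XU \<oplus> u, XB \<oplus> b)) 0"
    if b: "b \<in> (\<lambda>b. (0, b)) -` Q" for b
  proof (rule grad_cong)
    have "open ((\<lambda>u::real^6. (u, b)) -` Q)" using Q(1) by (intro open_vimage continuous_intros)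
    then show "\<forall>\<^sub>F u in nhds 0. F (a (u, b), u, b) = reduced_potential W XAs (XU \<oplus> u, XB \<oplus> b)"
      using b Q(3) by (auto simp: eventually_nhds intro!: exI[of _ "(\<lambda>u::real^6. (u, b)) -` Q"])
  qed
  have "open ((\<lambda>b::real^6. (0::real^6, b)) -` Q)" using Q(1) by (intro open_vimage continuous_intros)
  from has_derivative_transform_within_open[OF deriv this _ eq]
  show ?thesis
    using Q(2) by (simp add: hess_block_eq_hessian F_def zero_prod_def)
qed

text \<open>Adding a constant does not change the Frechet derivative, even where it is a junk value,
  so no smoothness of the two summands is needed.\<close>

lemma grad_add_const: "grad (\<lambda>z. c + f z) x = grad f x"
proof -
  have "((\<lambda>z. c + f z) has_derivative D) (at x) \<longleftrightarrow> (f has_derivative D) (at x)" for D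
    using has_derivative_add[OF has_derivative_const[of c], of f D "at x"]
      has_derivative_add[OF has_derivative_const[of "- c"], of "\<lambda>z. c + f z" D "at x"] by auto
  then show ?thesis by (simp add: grad_def frechet_derivative_def)
qed

lemma grad_const [simp]: "grad (\<lambda>z. c) x = 0"
  using grad_nth[OF has_derivative_const[of c "at x"]] by (simp add: vec_eq_iff)

text \<open>With A held at its nominal pose, perturbing U only shifts the function of b by a
  constant, so the B gradient does not depend on the U perturbation.\<close>

lemma hess_block_UB_separable:
  assumes W: "\<And>A U B. A \<in> poses \<Longrightarrow> U \<in> poses \<Longrightarrow> B \<in> poses \<Longrightarrow> W (A, U, B) = Wctrl (A, U) + Wint (A, B)"
    and X: "fst X \<in> poses" "fst (snd X) \<in> poses" "snd (snd X) \<in> poses"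
  shows "hess_block slotU slotB W X = 0"
proof -
  have "partial_grad slotB (in_coords W X) (0 + slotU \<xi>) = grad (\<lambda>b. Wint (fst X, snd (snd X) \<oplus> b)) 0" for \<xi>
    unfolding partial_grad_def slotU_def slotB_def in_coords_def
    using X by (simp add: case_prod_unfold W oplus_in_poses grad_add_const)
  then show ?thesis
    by (simp add: hess_block_def partial_grad_def[of slotU] vec_eq_iff)
qed

section \<open>Gaussian densities\<close>

lemma measurable_vec_lambda_PiM:
  "(\<lambda>f. \<chi> i. f i) \<in> measurable (\<Pi>\<^sub>M i\<in>(UNIV::'n::finite set). (lborel :: 'a::euclidean_space measure)) borel"
proof (rule borel_measurable_euclidean_space[THEN iffD2], rule ballI)
  fix b :: "'a^'n" assume "b \<in> Basis"
  then obtain i u where b: "b = axis i u" "u \<in> Basis" by (auto simp: Basis_vec_def)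
  have "(\<lambda>f. (\<chi> i. f i) \<bullet> b) = (\<lambda>f. f i \<bullet> u)" by (simp add: b inner_axis)
  then show "(\<lambda>f. (\<chi> i. f i) \<bullet> b) \<in> borel_measurable (\<Pi>\<^sub>M i\<in>(UNIV::'n set). (lborel :: 'a measure))"
    by simp
qed

text \<open>Lebesgue measure is determined by boxes, and a box of vectors is a product of boxes. The
  entry type is general because the result serves at two levels: real coordinates of one
  measurement, and measurements in the stacked observation.\<close>

lemma lborel_vec_eq_distr_PiM:
  "(lborel :: ('a::euclidean_space^'n::finite) measure)
     = distr (\<Pi>\<^sub>M i\<in>UNIV. lborel) borel (\<lambda>f. \<chi> i. f i)"
proof (rule lborel_eqI)
  interpret product_sigma_finite "\<lambda>i::'n. (lborel :: 'a measure)" ..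
  fix l u :: "'a^'n" assume le: "\<And>b. b \<in> Basis \<Longrightarrow> l \<bullet> b \<le> u \<bullet> b"
  have le': "l $ i \<bullet> b \<le> u $ i \<bullet> b" if "b \<in> Basis" for i b
    using le[of "axis i b"] that by (auto simp: inner_axis Basis_vec_def)
  have vim: "(\<lambda>f. \<chi> i. f i) -` box l u \<inter> space (\<Pi>\<^sub>M i\<in>(UNIV::'n set). (lborel :: 'a measure))
      = Pi\<^sub>E UNIV (\<lambda>i. box (l $ i) (u $ i))"
    by (auto simp: space_PiM mem_box Basis_vec_def inner_axis PiE_iff)
  have "emeasure (distr (\<Pi>\<^sub>M i\<in>(UNIV::'n set). (lborel :: 'a measure)) borel (\<lambda>f. \<chi> i. f i)) (box l u)
      = (\<Prod>i\<in>UNIV. emeasure lborel (box (l $ i) (u $ i)))"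
    by (simp add: emeasure_distr[OF measurable_vec_lambda_PiM] vim emeasure_PiM)
  also have "\<dots> = (\<Prod>i\<in>UNIV. ennreal (\<Prod>b\<in>Basis. (u $ i - l $ i) \<bullet> b))"
    using le' by (intro prod.cong refl emeasure_lborel_box) auto
  also have "\<dots> = ennreal (\<Prod>i\<in>UNIV. \<Prod>b\<in>Basis. (u $ i - l $ i) \<bullet> b)"
    using le' by (intro prod_ennreal prod_nonneg) (auto simp: inner_diff_left)
  also have "(\<Prod>i\<in>UNIV. \<Prod>b\<in>Basis. (u $ i - l $ i) \<bullet> b) = (\<Prod>b\<in>Basis. (u - l) \<bullet> b)"
  proof -
    have "(\<Prod>b\<in>Basis. (u - l) \<bullet> b) = (\<Prod>b\<in>(\<Union>i. axis i ` Basis). (u - l) \<bullet> b)"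
      by (rule prod.cong) (auto simp: Basis_vec_def)
    also have "\<dots> = (\<Prod>i\<in>UNIV. \<Prod>b\<in>axis i ` Basis. (u - l) \<bullet> b)"
      by (rule prod.UNION_disjoint) (auto simp: axis_eq_axis)
    also have "\<dots> = (\<Prod>i\<in>UNIV. \<Prod>b\<in>Basis. (u $ i - l $ i) \<bullet> b)"
      by (intro prod.cong refl, subst prod.reindex) (auto simp: inj_on_def axis_eq_axis inner_axis)
    finally show ?thesis by simp
  qed
  finally show "emeasure (distr (\<Pi>\<^sub>M i\<in>(UNIV::'n set). (lborel :: 'a measure)) borel (\<lambda>f. \<chi> i. f i)) (box l u)
      = ennreal (\<Prod>b\<in>Basis. (u - l) \<bullet> b)" .
qed simp

lemma has_bochner_integral_vec_prod:
  fixes f :: "'n::finite \<Rightarrow> 'a::euclidean_space \<Rightarrow> real"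
  assumes f: "\<And>i. has_bochner_integral lborel (f i) (c i)"
  shows "has_bochner_integral lborel (\<lambda>y::'a^'n. \<Prod>i\<in>UNIV. f i (y $ i)) (\<Prod>i\<in>UNIV. c i)"
proof -
  interpret product_sigma_finite "\<lambda>i::'n. (lborel :: 'a measure)" ..
  have int: "integrable lborel (f i)" "integral\<^sup>L lborel (f i) = c i" for i
    using f[of i] by (simp_all add: has_bochner_integral_iff)
  have [measurable]: "f i \<in> borel_measurable borel" for i
    using int(1)[of i] by auto
  have [measurable]: "(\<lambda>y::'a^'n. y $ i) \<in> borel_measurable borel" for i
    by (intro borel_measurable_continuous_onI continuous_intros)
  have "has_bochner_integral (\<Pi>\<^sub>M i\<in>UNIV. lborel) (\<lambda>x. \<Prod>i\<in>UNIV. f i (x i)) (\<Prod>i\<in>UNIV. c i)"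
    using product_integrable_prod[of UNIV f] product_integral_prod[of UNIV f] int
    by (simp add: has_bochner_integral_iff)
  then show ?thesis
    by (subst lborel_vec_eq_distr_PiM, intro has_bochner_integral_distr measurable_vec_lambda_PiM) simp_all
qed

context
  fixes p :: "'n::finite \<Rightarrow> 'a::euclidean_space \<Rightarrow> real"
  assumes p: "\<And>k. has_bochner_integral lborel (p k) 1"
begin

text \<open>Each summand is a product integrand with one factor of integral 0 and the others of
  integral 1.\<close>

lemma has_bochner_integral_prod_density_sum:
  assumes u: "\<And>k. has_bochner_integral lborel (\<lambda>x. u k x * p k x) 0"
  shows "has_bochner_integral lborel (\<lambda>y::'a^'n. (\<Sum>k\<in>UNIV. u k (y $ k)) * (\<Prod>k\<in>UNIV. p k (y $ k))) 0"
proof -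
  have "has_bochner_integral lborel (\<lambda>y::'a^'n. u k (y $ k) * (\<Prod>k\<in>UNIV. p k (y $ k))) 0" for k
  proof -
    have "has_bochner_integral lborel (\<lambda>x. (if n = k then u k x else 1) * p n x) (if n = k then 0 else 1)" for n
      using u[of k] p[of n] by auto
    from has_bochner_integral_vec_prod[of "\<lambda>n x. (if n = k then u k x else 1) * p n x", OF this]
    have "has_bochner_integral lborel
        (\<lambda>y::'a^'n. \<Prod>n\<in>UNIV. (if n = k then u k (y $ n) else 1) * p n (y $ n)) 0"
      by (simp add: prod.delta)
    moreover have "(\<Prod>n\<in>UNIV. (if n = k then u k (y $ n) else 1) * p n (y $ n)) = u k (y $ k) * (\<Prod>k\<in>UNIV. p k (y $ k))" for y :: "'a^'n"
      by (simp add: prod.distrib)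
    ultimately show ?thesis by simp
  qed
  from has_bochner_integral_sum[of UNIV lborel "\<lambda>k (y::'a^'n). u k (y $ k) * (\<Prod>k\<in>UNIV. p k (y $ k))" "\<lambda>k. 0", OF this]
  show ?thesis by (simp add: sum_distrib_right)
qed

text \<open>In the double sum the terms with k different from l contain a factor of mean 0; only the
  diagonal survives.\<close>

lemma has_bochner_integral_prod_density_sum_mult:
  assumes u: "\<And>k. has_bochner_integral lborel (\<lambda>x. u k x * p k x) 0"
    and v: "\<And>k. has_bochner_integral lborel (\<lambda>x. v k x * p k x) 0"
    and uv: "\<And>k. has_bochner_integral lborel (\<lambda>x. u k x * v k x * p k x) (c k)"
  shows "has_bochner_integral lborel
    (\<lambda>y::'a^'n. (\<Sum>k\<in>UNIV. u k (y $ k)) * (\<Sum>k\<in>UNIV. v k (y $ k)) * (\<Prod>k\<in>UNIV. p k (y $ k)))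
    (\<Sum>k\<in>UNIV. c k)"
proof -
  have kl: "has_bochner_integral lborel (\<lambda>y::'a^'n. u k (y $ k) * v l (y $ l) * (\<Prod>k\<in>UNIV. p k (y $ k)))
      (if k = l then c k else 0)" for k l
  proof -
    \<comment> \<open>Writing the integrand as one product over n, with factors 1 where nothing is
      inserted, treats k = l and k different from l by the same expression.\<close>
    let ?f = "\<lambda>n x. (if n = k then u k x else 1) * ((if n = l then v l x else 1) * p n x)"
    have "has_bochner_integral lborel (?f n)
       (if n = k then (if n = l then c k else 0) else if n = l then 0 else 1)" for n
      using u[of k] v[of l] uv[of k] p[of n] by (auto simp: mult.assoc)
    from has_bochner_integral_vec_prod[of ?f, OF this]
    have "has_bochner_integral lborel (\<lambda>y::'a^'n. \<Prod>n\<in>UNIV. ?f n (y $ n))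
       (\<Prod>n\<in>UNIV. if n = k then (if n = l then c k else 0) else if n = l then 0 else 1)" .
    moreover have "(\<Prod>n\<in>UNIV. if n = k then (if n = l then c k else 0) else if n = l then 0 else 1) = (if k = l then c k else 0)"
    proof (cases "k = l")
      case True
      then have "(\<Prod>n\<in>UNIV. if n = k then (if n = l then c k else 0) else if n = l then 0 else 1)
         = (\<Prod>n\<in>UNIV. if n = k then c k else 1)"
        by (intro prod.cong) auto
      then show ?thesis using True by simp
    next
      case False
      then show ?thesis by (auto intro!: prod_zero)
    qed
    moreover have "(\<Prod>n\<in>UNIV. ?f n (y $ n)) = u k (y $ k) * v l (y $ l) * (\<Prod>k\<in>UNIV. p k (y $ k))" for y :: "'a^'n"
      by (simp add: prod.distrib)
    ultimately show ?thesis by simp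
  qed
  have "has_bochner_integral lborel (\<lambda>y::'a^'n. \<Sum>k\<in>UNIV. \<Sum>l\<in>UNIV. u k (y $ k) * v l (y $ l) * (\<Prod>k\<in>UNIV. p k (y $ k)))
      (\<Sum>k\<in>UNIV. \<Sum>l\<in>UNIV. if k = l then c k else 0)"
    by (intro has_bochner_integral_sum kl)
  moreover have "(\<Sum>k\<in>UNIV. \<Sum>l\<in>UNIV. u k (y $ k) * v l (y $ l) * (\<Prod>k\<in>UNIV. p k (y $ k)))
     = (\<Sum>k\<in>UNIV. u k (y $ k)) * (\<Sum>k\<in>UNIV. v k (y $ k)) * (\<Prod>k\<in>UNIV. p k (y $ k))" for y :: "'a^'n"
    by (subst sum_product) (simp only: sum_distrib_right)
  ultimately show ?thesis by simp
qed

end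

section \<open>Standard normal vectors and affine changes of variables\<close>

definition std_normal_vec :: "real^'n \<Rightarrow> real" where
  "std_normal_vec w = (\<Prod>i\<in>UNIV. std_normal_density (w $ i))"

lemma std_normal_moments:
  "has_bochner_integral lborel std_normal_density 1"
  "has_bochner_integral lborel (\<lambda>x. (a * x) * std_normal_density x) 0"
  "has_bochner_integral lborel (\<lambda>x. (a * x) * (b * x) * std_normal_density x) (a * b)"
  using std_normal_moment_even[of 0]
    has_bochner_integral_mult_right[OF std_normal_moment_odd[of 0], of a]
    has_bochner_integral_mult_right[OF std_normal_moment_even[of 1], of "a * b"]
  by (simp_all add: ac_simps power2_eq_square)

lemma std_normal_vec_moments:
  fixes \<alpha> \<beta> :: "real^'n"
  shows "has_bochner_integral lborel (std_normal_vec :: real^'n \<Rightarrow> real) 1"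
    and "has_bochner_integral lborel (\<lambda>w. (\<alpha> \<bullet> w) * std_normal_vec w) 0"
    and "has_bochner_integral lborel (\<lambda>w. (\<alpha> \<bullet> w) * (\<beta> \<bullet> w) * std_normal_vec w) (\<alpha> \<bullet> \<beta>)"
  using has_bochner_integral_vec_prod[OF std_normal_moments(1)]
    has_bochner_integral_prod_density_sum[of "\<lambda>_. std_normal_density" "\<lambda>k x. \<alpha> $ k * x", OF std_normal_moments(1,2)]
    has_bochner_integral_prod_density_sum_mult[of "\<lambda>_. std_normal_density" "\<lambda>k x. \<alpha> $ k * x" "\<lambda>k x. \<beta> $ k * x",
      OF std_normal_moments(1,2,2,3)]
  by (simp_all add: std_normal_vec_def[abs_def] inner_vec_def)

lemma std_normal_vec_exp:
  "std_normal_vec (w :: real^'n) = exp (- 1/2 * (w \<bullet> w)) / sqrt ((2 * pi) ^ CARD('n))"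
proof -
  have "std_normal_vec w = (\<Prod>i\<in>(UNIV::'n set). 1 / sqrt (2 * pi)) * (\<Prod>i\<in>UNIV. exp (- (w $ i)\<^sup>2 / 2))"
    unfolding std_normal_vec_def std_normal_density_def by (simp only: prod.distrib)
  also have "(\<Prod>i\<in>UNIV. exp (- (w $ i)\<^sup>2 / 2)) = exp (\<Sum>i\<in>UNIV. - (w $ i)\<^sup>2 / 2)"
    by (simp add: exp_sum)
  also have "(\<Sum>i\<in>UNIV. - (w $ i)\<^sup>2 / 2) = - 1/2 * (w \<bullet> w)"
    by (simp add: inner_vec_def sum_distrib_left power2_eq_square sum_negf[symmetric] sum_divide_distrib)
  also have "(\<Prod>i\<in>(UNIV::'n set). 1 / sqrt (2 * pi)) = 1 / sqrt ((2 * pi) ^ CARD('n))"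
    by (simp only: prod_constant power_divide power_one real_sqrt_power)
  finally show ?thesis by simp
qed

text \<open>It suffices to compare values on boxes. The preimage of a box is a shifted box mapped by
  the inverse matrix; its volume carries the factor |det A|^-1, which the density
  compensates.\<close>

lemma lborel_affine_matrix:
  fixes A :: "real^'m::{finite,wellorder}^'m::{finite,wellorder}"
  assumes A: "invertible A"
  shows "lborel = density (distr lborel borel (\<lambda>x. t + A *v x)) (\<lambda>_. ennreal \<bar>det A\<bar>)"
proof (rule lborel_eqI)
  let ?T = "\<lambda>x. t + A *v x" and ?B = "matrix_inv A"
  have [measurable]: "?T \<in> borel \<rightarrow>\<^sub>M borel"
    by (intro borel_measurable_continuous_onI continuous_intros)
  fix l u :: "real^'m::{finite,wellorder}" assume le: "\<And>b. b \<in> Basis \<Longrightarrow> l \<bullet> b \<le> u \<bullet> b"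
  have AB: "A *v (?B *v x) = x" "?B *v (A *v x) = x" for x
    by (simp_all add: matrix_vector_mul_assoc matrix_inv_right[OF A] matrix_inv_left[OF A])
  have detB: "\<bar>det A\<bar> * \<bar>det ?B\<bar> = 1"
    by (metis A abs_mult abs_one det_I det_mul matrix_inv_right)
  have vim: "?T -` box l u = (*v) ?B ` box (l - t) (u - t)"
  proof -
    have "?T x \<in> box l u \<longleftrightarrow> A *v x \<in> box (l - t) (u - t)" for x
      by (auto simp: mem_box inner_simps algebra_simps)
    moreover have "x \<in> (*v) ?B ` box (l - t) (u - t) \<longleftrightarrow> A *v x \<in> box (l - t) (u - t)" for x
      using AB by (metis (no_types) image_iff)
    ultimately show ?thesis by blast
  qed
  have meas: "box (l - t) (u - t) \<in> lmeasurable" by simp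
  have lin: "linear ((*v) ?B)" by simp
  \<comment> \<open>The volume formula for linear images concerns the completed measure; as a Borel
    preimage the set has the same measure under \<open>lborel\<close>.\<close>
  have "emeasure lborel (?T -` box l u) = emeasure lebesgue ((*v) ?B ` box (l - t) (u - t))"
  proof -
    have "?T -` box l u \<in> sets lborel" using measurable_sets[of ?T borel borel "box l u"] by simp
    then show ?thesis by (simp add: vim[symmetric])
  qed
  also have "\<dots> = ennreal (\<bar>det ?B\<bar> * measure lebesgue (box (l - t) (u - t)))"
    using measurable_linear_image[OF lin meas] measure_linear_image[OF lin meas]
    by (simp add: emeasure_eq_measure2 matrix_of_matrix_vector_mul)
  also have "measure lebesgue (box (l - t) (u - t)) = (\<Prod>b\<in>Basis. (u - l) \<bullet> b)"
    using le by (simp add: measure_completion measure_lborel_box_eq inner_diff_left)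
  finally have e: "emeasure lborel (?T -` box l u) = ennreal (\<bar>det ?B\<bar> * (\<Prod>b\<in>Basis. (u - l) \<bullet> b))" .
  have "emeasure (density (distr lborel borel ?T) (\<lambda>_. ennreal \<bar>det A\<bar>)) (box l u)
      = ennreal \<bar>det A\<bar> * emeasure lborel (?T -` box l u)"
    by (simp add: emeasure_density nn_integral_cmult emeasure_distr)
  also have "\<dots> = ennreal (\<bar>det A\<bar> * \<bar>det ?B\<bar> * (\<Prod>b\<in>Basis. (u - l) \<bullet> b))"
    using e by (simp add: ennreal_mult'[symmetric] mult.assoc)
  finally show "emeasure (density (distr lborel borel ?T) (\<lambda>_. ennreal \<bar>det A\<bar>)) (box l u)
      = ennreal (\<Prod>b\<in>Basis. (u - l) \<bullet> b)"
    by (simp add: detB)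
qed simp

lemma has_bochner_integral_affine_matrix:
  fixes A :: "real^'m::{finite,wellorder}^'m::{finite,wellorder}" and f :: "real^'m::{finite,wellorder} \<Rightarrow> real"
  assumes A: "invertible A" and [measurable]: "f \<in> borel_measurable borel"
    and int: "has_bochner_integral lborel (\<lambda>w. \<bar>det A\<bar> * f (t + A *v w)) c"
  shows "has_bochner_integral lborel f c"
proof -
  have [measurable]: "(\<lambda>x. t + A *v x) \<in> borel \<rightarrow>\<^sub>M borel"
    by (intro borel_measurable_continuous_onI continuous_intros)
  show ?thesis
    by (subst lborel_affine_matrix[OF A, of t], intro has_bochner_integral_density has_bochner_integral_distr)
       (use int in simp_all)
qed

section \<open>Factoring the covariance and whitening the Gaussian\<close>

text \<open>Gram-Schmidt for the form x . S y. Euclidean orthogonality to \<open>S *v x\<close> is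
  orthogonality to x for this form, and as long as k is below the dimension the vectors
  \<open>S *v x\<close> leave room for a nonzero z.\<close>

lemma pos_def_orthonormal_set:
  fixes S :: "real^'n^'n"
  assumes S: "pos_def S" and k: "k \<le> CARD('n)"
  shows "\<exists>B. finite B \<and> card B = k \<and> (\<forall>x\<in>B. \<forall>y\<in>B. x \<bullet> (S *v y) = (if x = y then 1 else 0))"
  using k
proof (induction k)
  case 0
  then show ?case by (intro exI[of _ "{}"]) auto
next
  case (Suc k)
  then obtain B where B: "finite B" "card B = k"
    and on: "\<And>x y. x \<in> B \<Longrightarrow> y \<in> B \<Longrightarrow> x \<bullet> (S *v y) = (if x = y then 1 else 0)"
    by force
  have sym: "x \<bullet> (S *v y) = y \<bullet> (S *v x)" for x y
    using S unfolding pos_def_def by (metis dot_lmul_matrix inner_commute transpose_matrix_vector)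
  have "dim ((*v) S ` B) \<le> card ((*v) S ` B)" using B by (intro dim_le_card') auto
  also have "\<dots> \<le> k" using B card_image_le by blast
  finally have "dim ((*v) S ` B) < DIM(real^'n)" using Suc.prems by simp
  then obtain z where z: "z \<noteq> 0" "\<And>y. y \<in> span ((*v) S ` B) \<Longrightarrow> orthogonal z y"
    using orthogonal_to_subspace_exists by blast
  have zz: "0 < z \<bullet> (S *v z)" using S z(1) unfolding pos_def_def by blast
  define w where "w = (1 / sqrt (z \<bullet> (S *v z))) *\<^sub>R z"
  have ww: "w \<bullet> (S *v w) = 1"
    using zz by (simp add: w_def matrix_vector_mult_scaleR)
  have wx: "w \<bullet> (S *v x) = 0" if "x \<in> B" for x
    using z(2)[OF span_base, of "S *v x"] that by (simp add: w_def orthogonal_def)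
  then have "w \<notin> B" using ww by auto
  show ?case
  proof (intro exI[of _ "insert w B"] conjI ballI)
    show "finite (insert w B)" "card (insert w B) = Suc k" using B \<open>w \<notin> B\<close> by auto
    show "x \<bullet> (S *v y) = (if x = y then 1 else 0)" if "x \<in> insert w B" "y \<in> insert w B" for x y
      using that on ww wx sym[of x w] \<open>w \<notin> B\<close> by auto
  qed
qed

text \<open>With S-orthonormal columns in C, the product C^T S C is the identity; hence so is S C
  C^T. For A = S C this gives A A^T = (S C C^T) S = S.\<close>

lemma pos_def_factor:
  fixes S :: "real^'n^'n"
  assumes S: "pos_def S"
  obtains A :: "real^'n^'n" where "invertible A" "A ** transpose A = S"
proof -
  obtain B where B: "finite B" "card B = CARD('n)"
    and on: "\<And>x y. x \<in> B \<Longrightarrow> y \<in> B \<Longrightarrow> x \<bullet> (S *v y) = (if x = y then 1 else 0)"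
    using pos_def_orthonormal_set[OF S, of "CARD('n)"] by auto
  obtain f :: "'n \<Rightarrow> real^'n" where f: "bij_betw f UNIV B"
    using finite_same_card_bij[of "UNIV::'n set" B] B by auto
  define C where "C = transpose (\<chi> j. f j)"
  have C: "transpose C ** (S ** C) = mat 1"
  proof -
    have "(transpose C ** (S ** C)) $ i $ j = f i \<bullet> (S *v f j)" for i j
      by (simp add: C_def matrix_matrix_mult_def matrix_vector_mult_def inner_vec_def transpose_def)
    moreover have "f i \<in> B" for i using f by (auto simp: bij_betw_def)
    moreover have "f i = f j \<longleftrightarrow> i = j" for i j using f by (auto simp: bij_betw_def inj_on_def)
    ultimately show ?thesis by (simp add: vec_eq_iff mat_def on)
  qed
  have AC: "(S ** C) ** transpose C = mat 1" "transpose C ** (S ** C) = mat 1"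
    using C matrix_left_right_inverse by blast+
  have "S ** C ** transpose (S ** C) = S"
  proof -
    have tS: "transpose S = S" using S by (simp add: pos_def_def)
    have "S ** C ** transpose (S ** C) = (S ** C ** transpose C) ** S"
      by (simp add: matrix_transpose_mul tS matrix_mul_assoc)
    then show ?thesis by (simp add: AC)
  qed
  moreover have "invertible (S ** C)" using AC unfolding invertible_def by blast
  ultimately show thesis using that by blast
qed

lemma pos_def_invertible:
  fixes S :: "real^'n^'n"
  assumes "pos_def S"
  shows "invertible S"
  using assms unfolding invertible_left_inverse matrix_left_invertible_ker pos_def_def
  by (metis inner_zero_right less_irrefl)

lemma pos_def_det:
  fixes S :: "real^'n^'n"
  assumes "pos_def S"
  shows "0 < det S"
proof -
  obtain A :: "real^'n^'n" where A: "invertible A" "A ** transpose A = S" using pos_def_factor[OF assms] .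
  then have "det S = (det A)\<^sup>2" by (metis det_mul det_transpose power2_eq_square)
  then show ?thesis using A(1) by (simp add: invertible_det_nz)
qed

lemma gaussian_density_borel [measurable]: "gaussian_density \<mu> S \<in> borel_measurable borel"
proof -
  have "continuous_on UNIV (\<lambda>y. matrix_inv S *v (y - \<mu>))"
    by (rule continuous_on_compose2[OF matrix_vector_mult_linear_continuous_on[of UNIV]])
       (auto intro!: continuous_intros)
  then show ?thesis
    unfolding gaussian_density_def[abs_def]
    by (intro borel_measurable_divide borel_measurable_const borel_measurable_continuous_onI continuous_intros)
qed

text \<open>The substitution turns the quadratic form into w . w, and det S = (det A)^2 lets |det A|
  cancel the root in the normalization.\<close>

lemma gaussian_density_whitened:
  fixes A :: "real^'n^'n"
  assumes A: "invertible A" "A ** transpose A = S"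
  shows "\<bar>det A\<bar> * gaussian_density \<mu> S (\<mu> + A *v w) = std_normal_vec w"
proof -
  have det: "det S = (det A)\<^sup>2" "det A \<noteq> 0"
    using A by (metis det_mul det_transpose power2_eq_square, simp add: invertible_det_nz)
  then have "invertible S" by (simp add: invertible_det_nz)
  then have "matrix_inv S ** A ** transpose A = mat 1"
    using A(2) matrix_inv_left by (metis matrix_mul_assoc)
  then have "transpose A ** (matrix_inv S ** A) = mat 1" using matrix_left_right_inverse by blast
  then have "(A *v w) \<bullet> (matrix_inv S *v (A *v w)) = w \<bullet> w"
    by (metis dot_lmul_matrix inner_commute matrix_vector_mul_assoc matrix_vector_mul_lid transpose_matrix_vector)
  then show ?thesis
    using det by (simp add: gaussian_density_def std_normal_vec_exp real_sqrt_mult)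
qed

lemma gaussian_moments:
  fixes S :: "real^'m::{finite,wellorder}^'m::{finite,wellorder}"
  assumes S: "pos_def S"
  shows "has_bochner_integral lborel (gaussian_density \<mu> S) 1"
    and "has_bochner_integral lborel (\<lambda>y. (\<alpha> \<bullet> (y - \<mu>)) * gaussian_density \<mu> S y) 0"
    and "has_bochner_integral lborel (\<lambda>y. (\<alpha> \<bullet> (y - \<mu>)) * (\<beta> \<bullet> (y - \<mu>)) * gaussian_density \<mu> S y) (\<alpha> \<bullet> (S *v \<beta>))"
proof -
  obtain A :: "real^'m::_^'m::_" where A: "invertible A" "A ** transpose A = S" using pos_def_factor[OF S] .
  note w = gaussian_density_whitened[OF A, of \<mu>]
  have mv: "\<alpha> \<bullet> (A *v w) = (transpose A *v \<alpha>) \<bullet> w" for \<alpha> w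
    by (simp add: dot_lmul_matrix transpose_matrix_vector)
  have cov: "(transpose A *v \<alpha>) \<bullet> (transpose A *v \<beta>) = \<alpha> \<bullet> (S *v \<beta>)"
    by (simp only: mv[symmetric] matrix_vector_mul_assoc A(2))
  have m: "(\<lambda>y. \<alpha> \<bullet> (y - \<mu>)) \<in> borel_measurable borel" for \<alpha>
    by (intro borel_measurable_continuous_onI continuous_intros)
  note [measurable] = m
  show "has_bochner_integral lborel (gaussian_density \<mu> S) 1"
    by (rule has_bochner_integral_affine_matrix[OF A(1), where t=\<mu>])
       (simp_all add: w std_normal_vec_moments(1))
  show "has_bochner_integral lborel (\<lambda>y. (\<alpha> \<bullet> (y - \<mu>)) * gaussian_density \<mu> S y) 0"
    by (rule has_bochner_integral_affine_matrix[OF A(1), where t=\<mu>])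
       (simp_all add: w mult.left_commute[of "\<bar>det A\<bar>"] mv std_normal_vec_moments(2))
  show "has_bochner_integral lborel (\<lambda>y. (\<alpha> \<bullet> (y - \<mu>)) * (\<beta> \<bullet> (y - \<mu>)) * gaussian_density \<mu> S y) (\<alpha> \<bullet> (S *v \<beta>))"
    by (rule has_bochner_integral_affine_matrix[OF A(1), where t=\<mu>])
       (simp_all add: w mult.left_commute[of "\<bar>det A\<bar>"] mv std_normal_vec_moments(3) cov[symmetric])
qed

section \<open>The linearized model\<close>

text \<open>The upper bound comes from expanding in the basis. It makes \<nu> Lipschitz, so \<nu>
  attains its minimum on the compact unit sphere; the minimum is positive and gives the lower bound
  by scaling.\<close>

lemma is_norm_equivalent:
  fixes \<nu> :: "'a::euclidean_space \<Rightarrow> real"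
  assumes \<nu>: "is_norm \<nu>"
  shows "\<exists>c>0. \<exists>C>0. \<forall>x. c * norm x \<le> \<nu> x \<and> \<nu> x \<le> C * norm x"
proof -
  have nonneg: "0 \<le> \<nu> x" and zero: "\<nu> x = 0 \<longleftrightarrow> x = 0"
    and scale: "\<nu> (a *\<^sub>R x) = \<bar>a\<bar> * \<nu> x" and tri: "\<nu> (x + y) \<le> \<nu> x + \<nu> y" for x y a
    using \<nu> by (auto simp: is_norm_def)
  have sum: "\<nu> (\<Sum>i\<in>I. f i) \<le> (\<Sum>i\<in>I. \<nu> (f i))" if "finite I" for I :: "'a set" and f
    using that
  proof (induction I rule: finite_induct)
    case (insert i I)
    then show ?case using tri[of "f i" "sum f I"] by simp
  qed (use zero[of 0] in simp)
  define C where "C = (\<Sum>b\<in>Basis. \<nu> b) + 1"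
  have C: "0 < C" by (simp add: C_def sum_nonneg nonneg add_nonneg_pos)
  have upper: "\<nu> x \<le> C * norm x" for x
  proof -
    have "\<nu> x = \<nu> (\<Sum>b\<in>Basis. (x \<bullet> b) *\<^sub>R b)" by (simp add: euclidean_representation)
    also have "\<dots> \<le> (\<Sum>b\<in>Basis. \<bar>x \<bullet> b\<bar> * \<nu> b)"
      using sum[of Basis "\<lambda>b. (x \<bullet> b) *\<^sub>R b"] by (simp add: scale)
    also have "\<dots> \<le> (\<Sum>b\<in>Basis. norm x * \<nu> b)"
      by (intro sum_mono mult_right_mono Basis_le_norm nonneg)
    also have "\<dots> \<le> C * norm x"
      by (simp add: C_def sum_distrib_left[symmetric] algebra_simps)
    finally show ?thesis .
  qed
  have lip: "\<bar>\<nu> x - \<nu> y\<bar> \<le> C * norm (x - y)" for x y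
    using tri[of "x - y" y] tri[of "y - x" x] upper[of "x - y"] upper[of "y - x"]
    by (simp add: norm_minus_commute abs_le_iff)
  have "continuous_on (sphere 0 1) \<nu>"
  proof (rule lipschitz_on_continuous_on)
    show "C-lipschitz_on (sphere 0 1) \<nu>"
      using lip C by (intro lipschitz_onI) (auto simp: dist_norm)
  qed
  moreover obtain b :: 'a where "b \<in> Basis" using nonempty_Basis by blast
  then have "sphere (0::'a) 1 \<noteq> {}" by (auto simp: dist_norm intro!: exI[of _ b])
  ultimately obtain x0 where x0: "x0 \<in> sphere 0 1" "\<And>x. x \<in> sphere 0 1 \<Longrightarrow> \<nu> x0 \<le> \<nu> x"
    using continuous_attains_inf[of "sphere 0 1" \<nu>] by auto
  have "x0 \<noteq> 0" using x0(1) by auto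
  then have pos: "0 < \<nu> x0" using nonneg[of x0] zero[of x0] by linarith
  have "\<nu> x0 * norm x \<le> \<nu> x" for x
  proof (cases "x = 0")
    case False
    then have "\<nu> x0 \<le> \<nu> ((1 / norm x) *\<^sub>R x)" by (intro x0(2)) simp
    then show ?thesis using False by (simp add: scale field_simps)
  qed (simp add: nonneg)
  with pos C upper show ?thesis by blast
qed

text \<open>The Euclidean remainder constant is transferred between norms: D bounds \<nu> from
  above, c bounds \<mu> from below, whence D |K| / c^2. The absolute value is taken because the sign
  of K is unknown.\<close>

lemma C2_near_first_order_bigo:
  fixes f :: "real^'n \<Rightarrow> real^'m"
  assumes \<nu>: "is_norm \<nu>" and \<mu>: "is_norm \<mu>" and f: "C2_near f 0"
  shows "(\<lambda>\<xi>. \<nu> (f \<xi> - (f 0 + jacobian f (at 0) *v \<xi>))) \<in> O[at 0](\<lambda>\<xi>. (\<mu> \<xi>)\<^sup>2)"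
proof -
  obtain c C where c: "0 < c" "0 < C" "\<And>x. c * norm x \<le> \<mu> x" "\<And>x. \<mu> x \<le> C * norm x" using is_norm_equivalent[OF \<mu>] by blast
  obtain d D where D: "0 < d" "0 < D" "\<And>x. d * norm x \<le> \<nu> x" "\<And>x. \<nu> x \<le> D * norm x" using is_norm_equivalent[OF \<nu>] by blast
  have diff: "f differentiable (at 0)"
    using f unfolding C2_near_def differentiable_def by blast
  have jac: "frechet_derivative f (at 0) = (*v) (jacobian f (at 0))"
    using frechet_derivative_at[OF diff[unfolded jacobian_works]] by simp
  obtain K where K: "\<forall>\<^sub>F h in nhds 0. norm (f (0 + h) - f 0 - frechet_derivative f (at 0) h) \<le> K * (norm h)\<^sup>2"
    using C2_near_remainder[OF f] by blast
  have "\<forall>\<^sub>F h in nhds 0. norm (\<nu> (f h - (f 0 + jacobian f (at 0) *v h))) \<le> (D * \<bar>K\<bar> / c\<^sup>2) * norm ((\<mu> h)\<^sup>2)"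
    using K
  proof eventually_elim
    case (elim h)
    let ?e = "f h - (f 0 + jacobian f (at 0) *v h)"
    have "0 \<le> \<nu> ?e" using \<nu> by (simp add: is_norm_def)
    moreover have "\<nu> ?e \<le> D * norm ?e" by (rule D(4))
    moreover have "norm ?e \<le> \<bar>K\<bar> * (norm h)\<^sup>2"
      using elim mult_right_mono[OF abs_ge_self[of K] zero_le_power2[of "norm h"]]
      by (simp add: jac diff_diff_eq)
    moreover have "(norm h)\<^sup>2 \<le> (\<mu> h)\<^sup>2 / c\<^sup>2"
      using power_mono[OF c(3)[of h], of 2] c(1) by (simp add: power_mult_distrib field_simps)
    ultimately have "\<nu> ?e \<le> D * (\<bar>K\<bar> * ((\<mu> h)\<^sup>2 / c\<^sup>2))"
      using D(2) by (meson abs_ge_zero less_imp_le mult_left_mono order_trans)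
    then show ?case using \<open>0 \<le> \<nu> ?e\<close> by simp
  qed
  then show ?thesis
    by (intro bigoI[of _ "D * \<bar>K\<bar> / c\<^sup>2"]) (auto simp: eventually_at_filter elim: eventually_mono)
qed

section \<open>Gram matrices and stacked Jacobians\<close>

lemma pos_def_matrix_inv:
  fixes S :: "real^'n^'n"
  assumes S: "pos_def S"
  shows "pos_def (matrix_inv S)"
  unfolding pos_def_def
proof (intro conjI allI impI)
  let ?P = "matrix_inv S"
  have inv: "S ** ?P = mat 1" "?P ** S = mat 1"
    using matrix_inv_right matrix_inv_left pos_def_invertible[OF S] by blast+
  have tS: "transpose S = S" using S by (simp add: pos_def_def)
  have "transpose ?P ** S = mat 1" "S ** transpose ?P = mat 1"
    using arg_cong[OF inv(1), of transpose] arg_cong[OF inv(2), of transpose]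
    by (simp_all add: matrix_transpose_mul tS transpose_mat)
  then show "transpose ?P = ?P" using matrix_inv_unique by metis
  fix x :: "real^'n" assume x: "x \<noteq> 0"
  have Sx: "S *v (?P *v x) = x" by (simp add: matrix_vector_mul_assoc inv)
  then have "?P *v x \<noteq> 0" using x by auto
  then have "0 < (?P *v x) \<bullet> (S *v (?P *v x))" using S unfolding pos_def_def by blast
  then show "0 < x \<bullet> (?P *v x)" by (simp add: Sx inner_commute)
qed

lemma inner_matrix_vector_transpose: "x \<bullet> (A *v y) = (transpose A *v x) \<bullet> y"
  for A :: "real^'n^'m"
  by (simp add: dot_lmul_matrix transpose_matrix_vector)

lemma pos_def_inner_commute:
  assumes "pos_def P"
  shows "x \<bullet> (P *v y) = y \<bullet> (P *v x)"
  using assms unfolding pos_def_def by (metis inner_commute inner_matrix_vector_transpose)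

lemma sum_matrix_vector_mult:
  fixes M :: "'k \<Rightarrow> real^'n^'m"
  shows "(\<Sum>k\<in>K. M k) *v x = (\<Sum>k\<in>K. M k *v x)"
  by (induction K rule: infinite_finite_induct) (auto simp: matrix_vector_mult_add_rdistrib)

lemma inner_gram_mult:
  fixes J :: "'k::finite \<Rightarrow> real^'n^'m"
  shows "x \<bullet> ((\<Sum>k\<in>UNIV. transpose (J k) ** P ** J k) *v y) = (\<Sum>k\<in>UNIV. (J k *v x) \<bullet> (P *v (J k *v y)))"
proof -
  have "x \<bullet> ((transpose (J k) ** P ** J k) *v y) = (J k *v x) \<bullet> (P *v (J k *v y))" for k
    by (metis inner_matrix_vector_transpose matrix_vector_mul_assoc transpose_transpose)
  then show ?thesis by (simp add: sum_matrix_vector_mult inner_sum_right)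
qed

text \<open>Reduces matrix identities to identities of bilinear forms, tested on basis
  vectors.\<close>

lemma matrix_nth_nth_eq_inner: "A $ i $ j = axis i 1 \<bullet> (A *v axis j 1)" for A :: "real^'n^'m"
  by (simp add: matrix_vector_mult_basis column_def inner_axis')

text \<open>The two cross terms coincide because the inverse covariance is symmetric; this absorbs
  the factor 1/2 in the gradient term.\<close>

lemma weighted_energy_affine:
  fixes J :: "'k::finite \<Rightarrow> real^'n^'m"
  assumes S: "pos_def S"
  shows "weighted_energy S (\<lambda>k. e k + J k *v \<xi>) = weighted_energy S e
    + (\<Sum>k\<in>UNIV. transpose (J k) *v (matrix_inv S *v e k)) \<bullet> \<xi>
    + 1/2 * (\<xi> \<bullet> ((\<Sum>k\<in>UNIV. transpose (J k) ** matrix_inv S ** J k) *v \<xi>))"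
proof -
  let ?P = "matrix_inv S"
  have "(e k + J k *v \<xi>) \<bullet> (?P *v (e k + J k *v \<xi>)) =
      e k \<bullet> (?P *v e k) + 2 * ((transpose (J k) *v (?P *v e k)) \<bullet> \<xi>) + (J k *v \<xi>) \<bullet> (?P *v (J k *v \<xi>))" for k
  proof -
    have "(transpose (J k) *v (?P *v e k)) \<bullet> \<xi> = (J k *v \<xi>) \<bullet> (?P *v e k)"
      by (metis inner_matrix_vector_transpose inner_commute)
    then show ?thesis
      using pos_def_inner_commute[OF pos_def_matrix_inv[OF S], of "e k" "J k *v \<xi>"]
      by (simp only: matrix_vector_right_distrib inner_add_left inner_add_right)
  qed
  then show ?thesis
    by (simp add: weighted_energy_def inner_gram_mult sum.distrib inner_sum_left sum_distrib_left[symmetric]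
          distrib_left)
qed

lemma sum_UNIV_prod: "(\<Sum>x\<in>UNIV. f x) = (\<Sum>a\<in>UNIV. \<Sum>b\<in>UNIV. f (a, b))"
  for f :: "'a::finite \<times> 'b::finite \<Rightarrow> 'c::comm_monoid_add"
  by (simp add: sum.cartesian_product UNIV_Times_UNIV[symmetric] del: UNIV_Times_UNIV)

lemma matrix_inv_kron_mat_1:
  fixes S :: "real^'m^'m"
  assumes "invertible S"
  shows "matrix_inv (kron (mat 1 :: real^'k^'k) S) = kron (mat 1) (matrix_inv S)"
proof -
  have mult: "kron (mat 1 :: real^'k^'k) A ** kron (mat 1) B = kron (mat 1) (A ** B)" for A B :: "real^'m^'m"
  proof -
    have "(\<Sum>b\<in>UNIV. mat 1 $ i $ k * A $ i' $ b * (mat 1 $ k $ j * B $ b $ j'))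
        = (if i = k then mat 1 $ i $ j * (\<Sum>b\<in>UNIV. A $ i' $ b * B $ b $ j') else 0)" for i k j :: 'k and i' j'
      by (auto simp: mat_def)
    then show ?thesis
      by (simp add: vec_eq_iff kron_def matrix_matrix_mult_def sum_UNIV_prod)
  qed
  have one: "kron (mat 1 :: real^'k^'k) (mat 1 :: real^'m^'m) = mat 1"
    by (auto simp: vec_eq_iff kron_def mat_def)
  show ?thesis
    by (rule matrix_inv_unique) (simp_all add: mult one matrix_inv_right matrix_inv_left assms)
qed

lemma vstack_mult_vec: "(vstack J *v x) $ (k, i) = (J k *v x) $ i"
  by (simp add: vstack_def matrix_vector_mult_def)

lemma vstack_mult_vec_eq_0: "vstack J *v x = 0 \<longleftrightarrow> (\<forall>k. J k *v x = 0)"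
  for J :: "'k::finite \<Rightarrow> real^'n^'m"
  by (simp add: vec_eq_iff[of "vstack J *v x"] vec_eq_iff[of "J _ *v x"] split_paired_all vstack_mult_vec)

text \<open>The Kronecker product with the identity is block diagonal, so its bilinear form on
  stacked vectors splits into one term per measurement.\<close>

lemma vstack_gram:
  fixes J :: "'k::finite \<Rightarrow> real^'n^'m"
  shows "transpose (vstack J) ** kron (mat 1) P ** vstack J = (\<Sum>k\<in>UNIV. transpose (J k) ** P ** J k)"
proof -
  have kron: "(kron (mat 1) P *v z) $ (k, i) = (P *v (\<chi> j. z $ (k, j))) $ i" for z :: "real^('k \<times> 'm)" and k i
  proof -
    have "(\<Sum>b\<in>UNIV. mat 1 $ k $ a * P $ i $ b * z $ (a, b))
        = (if k = a then \<Sum>b\<in>UNIV. P $ i $ b * z $ (k, b) else 0)" for a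
      by (auto simp: mat_def)
    then show ?thesis
      by (simp add: kron_def matrix_vector_mult_def sum_UNIV_prod)
  qed
  have "x \<bullet> ((transpose (vstack J) ** kron (mat 1) P ** vstack J) *v y) = (\<Sum>k\<in>UNIV. (J k *v x) \<bullet> (P *v (J k *v y)))" for x y
  proof -
    have "x \<bullet> ((transpose (vstack J) ** kron (mat 1) P ** vstack J) *v y)
        = (vstack J *v x) \<bullet> (kron (mat 1) P *v (vstack J *v y))"
      by (metis inner_matrix_vector_transpose matrix_vector_mul_assoc transpose_transpose)
    also have "\<dots> = (\<Sum>k\<in>UNIV. (J k *v x) \<bullet> (P *v (J k *v y)))"
      by (simp add: inner_vec_def[of "vstack J *v x"] inner_vec_def[of "J _ *v x"] sum_UNIV_prod kron vstack_mult_vec)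
    finally show ?thesis .
  qed
  then show ?thesis
    unfolding vec_eq_iff by (simp only: matrix_nth_nth_eq_inner inner_gram_mult) simp
qed

lemma gaussian_density_pos: "pos_def S \<Longrightarrow> 0 < gaussian_density \<mu> S x"
  using pos_def_det[of S] by (simp add: gaussian_density_def)

section \<open>Fisher information, and positivity of the Gram matrix\<close>

text \<open>The log-likelihood is quadratic in the parameter, so the score is linear in the centred
  data and Gaussian moments up to order two suffice. The covariance S between two factors P cancels
  one of them, because S P is the identity.\<close>

lemma linearized_likelihood_fisher_information:
  fixes S :: "real^'m::{finite,wellorder}^'m::{finite,wellorder}" and J :: "'k::finite \<Rightarrow> real^'n^'m::{finite,wellorder}"
  assumes S: "pos_def S"
  shows "has_fisher_information (linearized_likelihood \<mu> J S) \<theta>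
    (\<Sum>k\<in>UNIV. transpose (J k) ** matrix_inv S ** J k)"
proof -
  let ?P = "matrix_inv S" and ?L = "linearized_likelihood \<mu> J S"
  define m where "m k = \<mu> k - J k *v \<theta>" for k
  have P: "pos_def ?P" by (rule pos_def_matrix_inv[OF S])
  have ln_L: "ln (?L \<theta> y) = (\<Sum>k\<in>UNIV. - 1/2 * ((y $ k - (\<mu> k - J k *v \<theta>)) \<bullet> (?P *v (y $ k - (\<mu> k - J k *v \<theta>))))
      - ln (sqrt ((2 * pi) ^ CARD('m) * det S)))" for \<theta> y
  proof -
    have "ln (gaussian_density \<nu> S x) = - 1/2 * ((x - \<nu>) \<bullet> (?P *v (x - \<nu>))) - ln (sqrt ((2 * pi) ^ CARD('m) * det S))" for \<nu> x
      using pos_def_det[OF S] by (simp add: gaussian_density_def ln_div)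
    moreover have "ln (?L \<theta> y) = (\<Sum>k\<in>UNIV. ln (gaussian_density (\<mu> k - J k *v \<theta>) S (y $ k)))"
      unfolding linearized_likelihood_def by (rule ln_prod) (simp_all add: gaussian_density_pos[OF S] gaussian_density_pos[OF S, THEN less_imp_neq, THEN not_sym])
    ultimately show ?thesis by simp
  qed
  have der: "((\<lambda>\<theta>. ln (?L \<theta> y)) has_derivative
      (\<lambda>h. \<Sum>k\<in>UNIV. (- (?P *v (J k *v h))) \<bullet> (y $ k - m k))) (at \<theta>)" for y
  proof -
    have "((\<lambda>\<theta>. - 1/2 * ((y $ k - (\<mu> k - J k *v \<theta>)) \<bullet> (?P *v (y $ k - (\<mu> k - J k *v \<theta>))))
        - ln (sqrt ((2 * pi) ^ CARD('m) * det S))) has_derivative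
        (\<lambda>h. (- (?P *v (J k *v h))) \<bullet> (y $ k - m k))) (at \<theta>)" for k
    proof -
      have z: "((\<lambda>\<theta>. y $ k - (\<mu> k - J k *v \<theta>)) has_derivative (\<lambda>h. J k *v h)) (at \<theta>)"
        by (auto intro!: derivative_eq_intros bounded_linear_imp_has_derivative matrix_vector_mul_bounded_linear)
      note bl = bounded_linear.has_derivative[OF matrix_vector_mul_bounded_linear z]
      have q: "((\<lambda>\<theta>. (y $ k - (\<mu> k - J k *v \<theta>)) \<bullet> (?P *v (y $ k - (\<mu> k - J k *v \<theta>)))) has_derivative
         (\<lambda>h. (y $ k - m k) \<bullet> (?P *v (J k *v h)) + (J k *v h) \<bullet> (?P *v (y $ k - m k)))) (at \<theta>)"
        unfolding m_def by (rule has_derivative_inner[OF z bl])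
      have "(y $ k - m k) \<bullet> (?P *v (J k *v h)) + (J k *v h) \<bullet> (?P *v (y $ k - m k)) = 2 * ((?P *v (J k *v h)) \<bullet> (y $ k - m k))" for h
        using pos_def_inner_commute[OF P, of "y $ k - m k" "J k *v h"] by (simp add: inner_commute)
      with q have "((\<lambda>\<theta>. (y $ k - (\<mu> k - J k *v \<theta>)) \<bullet> (?P *v (y $ k - (\<mu> k - J k *v \<theta>)))) has_derivative
         (\<lambda>h. 2 * ((?P *v (J k *v h)) \<bullet> (y $ k - m k)))) (at \<theta>)" by simp
      from has_derivative_diff[OF has_derivative_mult_right[OF this, of "- 1/2"] has_derivative_const]
      show ?thesis by simp
    qed
    then show ?thesis unfolding ln_L by (rule has_derivative_sum)
  qed
  have score: "grad (\<lambda>\<theta>. ln (?L \<theta> y)) \<theta> $ i = (\<Sum>k\<in>UNIV. (- (?P *v (J k *v axis i 1))) \<bullet> (y $ k - m k))" for y i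
    by (rule grad_nth[OF der])
  have L: "?L \<theta> y = (\<Prod>k\<in>UNIV. gaussian_density (m k) S (y $ k))" for y
    by (simp add: linearized_likelihood_def m_def)
  show ?thesis
    unfolding has_fisher_information_def
  proof (intro conjI allI)
    show "(\<lambda>\<theta>. ln (?L \<theta> y)) differentiable at \<theta>" for y
      using der differentiableI by blast
    fix i j :: 'n
    \<comment> \<open>Coefficient vectors of the score; their minus sign stems from the mean
      \<open>\<mu> k - J k *v \<theta>\<close> and cancels in the product of two scores.\<close>
    let ?\<alpha> = "\<lambda>i k. - (?P *v (J k *v axis i 1))"
    have "has_bochner_integral lborel
        (\<lambda>y. (\<Sum>k\<in>UNIV. ?\<alpha> i k \<bullet> (y $ k - m k)) * (\<Sum>k\<in>UNIV. ?\<alpha> j k \<bullet> (y $ k - m k))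
            * (\<Prod>k\<in>UNIV. gaussian_density (m k) S (y $ k)))
        (\<Sum>k\<in>UNIV. ?\<alpha> i k \<bullet> (S *v ?\<alpha> j k))"
      by (rule has_bochner_integral_prod_density_sum_mult) (rule gaussian_moments[OF S])+
    moreover have "?\<alpha> i k \<bullet> (S *v ?\<alpha> j k) = (J k *v axis i 1) \<bullet> (?P *v (J k *v axis j 1))" for k
    proof -
      have "S *v (?P *v z) = z" for z
        by (simp add: matrix_vector_mul_assoc matrix_inv_right pos_def_invertible[OF S])
      then have "?\<alpha> i k \<bullet> (S *v ?\<alpha> j k) = (J k *v axis j 1) \<bullet> (?P *v (J k *v axis i 1))"
        by (simp add: matrix_vector_mult_minus_right inner_commute)
      then show ?thesis by (simp add: pos_def_inner_commute[OF P])
    qed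
    ultimately show "has_bochner_integral lborel
        (\<lambda>y. grad (\<lambda>\<theta>. ln (?L \<theta> y)) \<theta> $ i * grad (\<lambda>\<theta>. ln (?L \<theta> y)) \<theta> $ j * ?L \<theta> y)
        ((\<Sum>k\<in>UNIV. transpose (J k) ** ?P ** J k) $ i $ j)"
      by (simp only: score L matrix_nth_nth_eq_inner inner_gram_mult)
  qed
qed

text \<open>The quadratic form is a sum of squared P-norms of the vectors \<open>J k *v x\<close>,
  so it vanishes only if each of them does. This ties the kernel of the information matrix to the
  common kernel of the Jacobians.\<close>

lemma gram_inner_self_eq_0:
  fixes J :: "'k::finite \<Rightarrow> real^'n^'m"
  assumes P: "pos_def P"
  shows "x \<bullet> ((\<Sum>k\<in>UNIV. transpose (J k) ** P ** J k) *v x) = 0 \<longleftrightarrow> (\<forall>k. J k *v x = 0)"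
    and "0 \<le> x \<bullet> ((\<Sum>k\<in>UNIV. transpose (J k) ** P ** J k) *v x)"
proof -
  have z: "0 \<le> z \<bullet> (P *v z)" "z \<bullet> (P *v z) = 0 \<longleftrightarrow> z = 0" for z
    using P unfolding pos_def_def by (cases "z = 0"; force)+
  then show "x \<bullet> ((\<Sum>k\<in>UNIV. transpose (J k) ** P ** J k) *v x) = 0 \<longleftrightarrow> (\<forall>k. J k *v x = 0)"
    by (simp add: inner_gram_mult sum_nonneg_eq_0_iff)
  show "0 \<le> x \<bullet> ((\<Sum>k\<in>UNIV. transpose (J k) ** P ** J k) *v x)"
    using z by (simp add: inner_gram_mult sum_nonneg)
qed

lemma pos_def_gram_iff:
  fixes J :: "'k::finite \<Rightarrow> real^'n^'m"
  assumes P: "pos_def P"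
  shows "pos_def (\<Sum>k\<in>UNIV. transpose (J k) ** P ** J k) \<longleftrightarrow> (\<forall>x. (\<forall>k. J k *v x = 0) \<longrightarrow> x = 0)"
proof -
  let ?H = "\<Sum>k\<in>UNIV. transpose (J k) ** P ** J k"
  have "?H $ j $ i = ?H $ i $ j" for i j
    unfolding matrix_nth_nth_eq_inner inner_gram_mult
    by (rule sum.cong[OF refl pos_def_inner_commute[OF P]])
  then have "transpose ?H = ?H" by (simp add: vec_eq_iff transpose_def)
  then show ?thesis
    unfolding pos_def_def less_le using gram_inner_self_eq_0[OF P, of _ J] by (simp add: eq_commute[of 0]) blast
qed

lemma inj_vstack_iff:
  fixes J :: "'k::finite \<Rightarrow> real^'n^'m"
  shows "inj ((*v) (vstack J)) \<longleftrightarrow> (\<forall>x. (\<forall>k. J k *v x = 0) \<longrightarrow> x = 0)"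
  by (simp add: linear_injective_0 vstack_mult_vec_eq_0)

section \<open>The Schur complement as Jacobian of the linearized Gaussian model\<close>

theorem theorem3p1:
  fixes \<Omega> :: "(pose \<times> pose \<times> pose) set"
    and W :: "pose \<times> pose \<times> pose \<Rightarrow> real"
    and XAs :: "pose \<times> pose \<Rightarrow> pose"
    and XU :: "'k::finite \<Rightarrow> pose"
    and y :: "'k \<Rightarrow> real^6"
    and \<Sigma>w :: "real^6^6"
    and XB :: pose
    and \<nu> :: "real^6 \<Rightarrow> real"
    and h r :: "'k \<Rightarrow> pose \<Rightarrow> real^6"
    and rbar :: "'k \<Rightarrow> real^6"
    and J :: "'k \<Rightarrow> real^6^6"
    and \<Sigma>K :: "real^('k \<times> 6)^('k \<times> 6)"
    and Xbar :: "'k \<Rightarrow> pose \<times> pose \<times> pose"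
    and g :: "real^6"
    and H :: "real^6^6"
  assumes norm: "is_norm \<nu>"
    and regular: "regular_potential \<Omega> W XAs"
    and cov: "pos_def \<Sigma>w"
    and XU: "\<And>k. XU k \<in> poses"
    and XB: "XB \<in> poses"
    and Xbar: "\<And>k. Xbar k = (XAs (XU k, XB), XU k, XB)"
    and Xbar_in: "\<And>k. Xbar k \<in> \<Omega>"
    and h: "\<And>k X. h k X = predicted_wrench W XAs (XU k) X"
    and r: "\<And>k X. r k X = y k - h k X"
    and r_C2: "\<And>k. C2_near (\<lambda>\<xi>. r k (XB \<oplus> \<xi>)) 0"
    and rbar: "\<And>k. rbar k = r k XB"
    and J: "\<And>k. J k = jacobian (\<lambda>\<xi>. r k (XB \<oplus> \<xi>)) (at 0)"
    and \<Sigma>K: "\<Sigma>K = kron (mat 1 :: real^'k^'k) \<Sigma>w"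
    and g: "g = (\<Sum>k\<in>UNIV. transpose (J k) *v (matrix_inv \<Sigma>w *v rbar k))"
    and H: "H = (\<Sum>k\<in>UNIV. transpose (J k) ** matrix_inv \<Sigma>w ** J k)"
  shows
    \<comment> \<open>(i)\<close>
    "(\<forall>k. J k = hess_block slotU slotB W (Xbar k)
            - hess_block slotU slotA W (Xbar k)
              ** matrix_inv (hess_block slotA slotA W (Xbar k))
              ** hess_block slotA slotB W (Xbar k)) \<and>
     (\<forall>Wctrl Wint :: pose \<times> pose \<Rightarrow> real.
        (\<forall>A\<in>poses. \<forall>U\<in>poses. \<forall>B\<in>poses. W (A, U, B) = Wctrl (A, U) + Wint (A, B)) \<longrightarrow>
        (\<forall>k. hess_block slotU slotB W (Xbar k) = 0 \<and>
             J k = - (hess_block slotU slotA W (Xbar k)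
                      ** matrix_inv (hess_block slotA slotA W (Xbar k))
                      ** hess_block slotA slotB W (Xbar k)))) \<and>
    \<comment> \<open>(ii)\<close>
     (\<forall>k. (\<lambda>\<xi>. \<nu> (r k (XB \<oplus> \<xi>) - (rbar k + J k *v \<xi>))) \<in> O[at 0](\<lambda>\<xi>. (\<nu> \<xi>)\<^sup>2)) \<and>
     (\<forall>\<xi>. weighted_energy \<Sigma>w (\<lambda>k. rbar k + J k *v \<xi>)
           = weighted_energy \<Sigma>w (\<lambda>k. r k XB) + g \<bullet> \<xi> + 1/2 * (\<xi> \<bullet> (H *v \<xi>))) \<and>
    \<comment> \<open>(iii)\<close>
     H = transpose (vstack J) ** matrix_inv \<Sigma>K ** vstack J \<and>
     (\<forall>\<xi>. has_fisher_information (linearized_likelihood (\<lambda>k. h k XB) J \<Sigma>w) \<xi> H) \<and>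
     (first_order_identifiable J \<longleftrightarrow> rank (vstack J) = 6) \<and>
     (rank (vstack J) = 6 \<longleftrightarrow> pos_def H) \<and>
     (rank H < 6 \<longrightarrow> (\<exists>\<xi>. \<xi> \<noteq> 0 \<and> (\<forall>k. J k *v \<xi> = 0))) \<and>
     (\<forall>\<xi>. (\<forall>k. J k *v \<xi> = 0) \<longrightarrow>
        (\<forall>\<xi>0. (deriv ^^ 2)
           (\<lambda>t. ln (linearized_likelihood (\<lambda>k. h k XB) J \<Sigma>w (\<xi>0 + t *\<^sub>R \<xi>) (\<chi> k. y k))) 0 = 0) \<and>
        \<xi> \<bullet> (H *v \<xi>) = 0 \<and>
        (\<forall>t. weighted_energy \<Sigma>w (\<lambda>k. rbar k + J k *v (t *\<^sub>R \<xi>))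
              = weighted_energy \<Sigma>w (\<lambda>k. r k XB)))"
proof -
  define P where "P = matrix_inv \<Sigma>w"
  have P: "pos_def P" unfolding P_def by (rule pos_def_matrix_inv[OF cov])
  have open_\<Omega>: "openin (top_of_set (poses \<times> poses \<times> poses)) \<Omega>"
    using regular unfolding regular_potential_def by blast
  have Xbar_poses: "fst (Xbar k) \<in> poses" "fst (snd (Xbar k)) \<in> poses" "snd (snd (Xbar k)) \<in> poses" for k
    using openin_imp_subset[OF open_\<Omega>] Xbar_in[of k] by auto
  have J_eq: "J k = hess_block slotU slotB W (Xbar k)
            - hess_block slotU slotA W (Xbar k)
              ** matrix_inv (hess_block slotA slotA W (Xbar k))
              ** hess_block slotA slotB W (Xbar k)" (is "_ = ?M k") for k
  proof -
    \<comment> \<open>The minus signs of \<open>predicted_wrench\<close> and of the residual cancel,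
      so the Jacobian is the Schur complement with positive sign.\<close>
    have "r k (XB \<oplus> \<xi>) = y k + grad (\<lambda>u. reduced_potential W XAs (XU k \<oplus> u, XB \<oplus> \<xi>)) 0" for \<xi>
      by (simp add: r h predicted_wrench_def)
    then have "((\<lambda>\<xi>. r k (XB \<oplus> \<xi>)) has_derivative (\<lambda>h. ?M k *v h)) (at 0)"
      using has_derivative_add[OF has_derivative_const
          reduced_gradient_has_derivative[OF regular XU XB Xbar Xbar_in], of "y k" k] by simp
    then show ?thesis
      unfolding J jacobian_def by (simp add: frechet_derivative_at[symmetric] matrix_of_matrix_vector_mul)
  qed
  have rbar_0: "rbar k = r k (XB \<oplus> 0)" for k by (simp add: rbar)
  have H_P: "H = (\<Sum>k\<in>UNIV. transpose (J k) ** P ** J k)" by (simp add: H P_def)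
  have energy: "weighted_energy \<Sigma>w (\<lambda>k. rbar k + J k *v \<xi>)
           = weighted_energy \<Sigma>w (\<lambda>k. r k XB) + g \<bullet> \<xi> + 1/2 * (\<xi> \<bullet> (H *v \<xi>))" for \<xi>
    using weighted_energy_affine[OF cov, of "\<lambda>k. r k XB" J \<xi>] unfolding g H rbar .
  have inj_iff: "inj ((*v) (vstack J)) \<longleftrightarrow> rank (vstack J) = 6"
    using full_rank_injective[of "vstack J"] by simp
  have kernel: "\<exists>\<xi>. \<xi> \<noteq> 0 \<and> (\<forall>k. J k *v \<xi> = 0)" if "rank H < 6"
  proof -
    \<comment> \<open>Rank deficiency of the square matrix \<open>H\<close> yields a kernel vector;
      its quadratic form is 0, which forces every \<open>J k *v \<xi>\<close> to vanish.\<close>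
    have "rank H \<noteq> CARD(6)" using that by simp
    then obtain \<xi> where \<xi>: "\<xi> \<noteq> 0" "H *v \<xi> = 0"
      using matrix_nonfull_linear_equations_eq[of H] by blast
    then have "\<forall>k. J k *v \<xi> = 0"
      using gram_inner_self_eq_0(1)[OF P, of \<xi> J] unfolding H_P[symmetric] by simp
    with \<xi>(1) show ?thesis by blast
  qed
  have flat: "(deriv ^^ 2) (\<lambda>t. ln (linearized_likelihood (\<lambda>k. h k XB) J \<Sigma>w (\<xi>0 + t *\<^sub>R \<xi>) (\<chi> k. y k))) 0 = 0"
    if "\<forall>k. J k *v \<xi> = 0" for \<xi> \<xi>0
  proof -
    \<comment> \<open>Along such a direction every mean stays fixed, so the log-likelihood is
      constant in t, from any base point \<open>\<xi>0\<close>.\<close>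
    have "J k *v (\<xi>0 + t *\<^sub>R \<xi>) = J k *v \<xi>0" for k t
      using that by (simp add: matrix_vector_right_distrib matrix_vector_mult_scaleR)
    then show ?thesis by (simp add: linearized_likelihood_def numeral_2_eq_2)
  qed
  show ?thesis
  proof (intro conjI allI impI)
    show "J k = ?M k" for k by (rule J_eq)
    show UB: "hess_block slotU slotB W (Xbar k) = 0"
      if "\<forall>A\<in>poses. \<forall>U\<in>poses. \<forall>B\<in>poses. W (A, U, B) = Wctrl (A, U) + Wint (A, B)" for k Wctrl Wint
      by (rule hess_block_UB_separable[of W Wctrl Wint, OF _ Xbar_poses]) (use that in simp)
    show "J k = - (hess_block slotU slotA W (Xbar k) ** matrix_inv (hess_block slotA slotA W (Xbar k))
                      ** hess_block slotA slotB W (Xbar k))"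
      if "\<forall>A\<in>poses. \<forall>U\<in>poses. \<forall>B\<in>poses. W (A, U, B) = Wctrl (A, U) + Wint (A, B)" for k Wctrl Wint
      using J_eq[of k] UB[OF that, of k] by simp
    show "(\<lambda>\<xi>. \<nu> (r k (XB \<oplus> \<xi>) - (rbar k + J k *v \<xi>))) \<in> O[at 0](\<lambda>\<xi>. (\<nu> \<xi>)\<^sup>2)" for k
      unfolding rbar_0 J by (rule C2_near_first_order_bigo[OF norm norm r_C2])
    show "weighted_energy \<Sigma>w (\<lambda>k. rbar k + J k *v \<xi>)
           = weighted_energy \<Sigma>w (\<lambda>k. r k XB) + g \<bullet> \<xi> + 1/2 * (\<xi> \<bullet> (H *v \<xi>))" for \<xi>
      by (rule energy)
    show "H = transpose (vstack J) ** matrix_inv \<Sigma>K ** vstack J"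
      by (simp add: \<Sigma>K matrix_inv_kron_mat_1 pos_def_invertible[OF cov] vstack_gram H)
    show "has_fisher_information (linearized_likelihood (\<lambda>k. h k XB) J \<Sigma>w) \<xi> H" for \<xi>
      unfolding H by (rule linearized_likelihood_fisher_information[OF cov])
    show "first_order_identifiable J \<longleftrightarrow> rank (vstack J) = 6"
      by (simp add: first_order_identifiable_def inj_iff)
    show "rank (vstack J) = 6 \<longleftrightarrow> pos_def H"
      unfolding inj_iff[symmetric] inj_vstack_iff H_P pos_def_gram_iff[OF P] ..
    show "\<exists>\<xi>. \<xi> \<noteq> 0 \<and> (\<forall>k. J k *v \<xi> = 0)" if "rank H < 6"
      by (rule kernel[OF that])
    fix \<xi> assume \<xi>: "\<forall>k. J k *v \<xi> = 0"
    show "(deriv ^^ 2) (\<lambda>t. ln (linearized_likelihood (\<lambda>k. h k XB) J \<Sigma>w (\<xi>0 + t *\<^sub>R \<xi>) (\<chi> k. y k))) 0 = 0" for \<xi>0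
      by (rule flat[OF \<xi>])
    show "\<xi> \<bullet> (H *v \<xi>) = 0"
      using \<xi> gram_inner_self_eq_0(1)[OF P, of \<xi> J] by (simp add: H_P)
    show "weighted_energy \<Sigma>w (\<lambda>k. rbar k + J k *v (t *\<^sub>R \<xi>)) = weighted_energy \<Sigma>w (\<lambda>k. r k XB)" for t
      using \<xi> by (simp add: matrix_vector_mult_scaleR rbar)
  qed
qed

end
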